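(* If $\widehat{\mathcal{M}}=(\mathcal{M},<_M,I_k)_{k\in\omega}$ is a model of $\mathrm{ZFI}^\omega_<$ and $\mathfrak{X}$ is the collection of subsets of $M$ parametrically definable in $\widehat{\mathcal{M}}$, then $(\mathcal{M},\mathfrak{X})\models\mathrm{GBC}+$ "$\mathrm{Ord}$ is weakly compact".
   Context: For $k\ge1$, let $\mathcal{L}_k=\{=,\in,<\}\cup\{I_j:j<k\}$ with each $I_j$ a unary predicate. $\mathrm{ZFI}^1_<$ has axioms: ZF with separation and collection for all $\mathcal{L}_1$-formulae; "$<$ is a linear order and every nonempty set has a $<$-least element"; "$I_0$ is a cofinal subclass of $\mathrm{Ord}$"; and for each $\{=,\in,<\}$-formula $\varphi(v_1,\dots,v_n)$: for all increasing $x_1<\cdots<x_n$, $y_1<\cdots<y_n$ in $I_0$, $\varphi(\bar x)\leftrightarrow\varphi(\bar y)$. $\mathrm{ZFI}^{k+1}_<$ consists of $\mathrm{ZFI}^k_<$ together with: ZFC with separation and collection for all $\mathcal{L}_{k+1}$-formulae; "$I_k$ is a cofinal subclass of $\mathrm{Ord}$"; indiscernibility of $I_k$ for every $\mathcal{L}_k$-formula; and $I_k\subseteq I_{k-1}$. $\mathrm{ZFI}^\omega_<=\bigcup_{k\ge1}\mathrm{ZFI}^k_<$. $\mathrm{GBC}$ is Gödel–Bernays class theory with global choice; "$\mathrm{Ord}$ is weakly compact" means every $\mathrm{Ord}$-tree (well-founded tree of height $\mathrm{Ord}$ whose levels are sets) has a cofinal branch. *)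

theory Defs
  imports Main
begin

text \<open>Structures have a whole type \<open>'a\<close> as universe: \<open>E\<close> interprets membership, \<open>L\<close> interprets
  \<open><\<close>, and \<open>I j\<close> is the extension of the unary predicate \<open>I\<^sub>j\<close>. Schemes range over a deep embedding
  of formulae with named variables; single axioms are written as their Tarskian truth conditions.\<close>

datatype fm =
    Equal nat nat
  | Member nat nat
  | Less nat nat
  | Ind nat nat  \<comment> \<open>\<open>Ind j x\<close> is the atomic formula \<open>I\<^sub>j(x)\<close>\<close>
  | Neg fm
  | Conj fm fm
  | Exi nat fm

primrec sat :: "('a \<Rightarrow> 'a \<Rightarrow> bool) \<Rightarrow> ('a \<Rightarrow> 'a \<Rightarrow> bool) \<Rightarrow> (nat \<Rightarrow> 'a set) \<Rightarrow> (nat \<Rightarrow> 'a) \<Rightarrow> fm \<Rightarrow> bool"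
where
  "sat E L I e (Equal x y) \<longleftrightarrow> e x = e y"
| "sat E L I e (Member x y) \<longleftrightarrow> E (e x) (e y)"
| "sat E L I e (Less x y) \<longleftrightarrow> L (e x) (e y)"
| "sat E L I e (Ind j x) \<longleftrightarrow> e x \<in> I j"
| "sat E L I e (Neg p) \<longleftrightarrow> \<not> sat E L I e p"
| "sat E L I e (Conj p q) \<longleftrightarrow> sat E L I e p \<and> sat E L I e q"
| "sat E L I e (Exi x p) \<longleftrightarrow> (\<exists>a. sat E L I (e(x := a)) p)"

primrec free_vars :: "fm \<Rightarrow> nat set" where
  "free_vars (Equal x y) = {x, y}"
| "free_vars (Member x y) = {x, y}"
| "free_vars (Less x y) = {x, y}"
| "free_vars (Ind j x) = {x}"
| "free_vars (Neg p) = free_vars p"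
| "free_vars (Conj p q) = free_vars p \<union> free_vars q"
| "free_vars (Exi x p) = free_vars p - {x}"

text \<open>\<open>in_lang k\<close> singles out the formulae over \<open>{=, \<in>, <} \<union> {I\<^sub>j : j < k}\<close>; in particular
  \<open>in_lang 0\<close> those over \<open>{=, \<in>, <}\<close>.\<close>

primrec in_lang :: "nat \<Rightarrow> fm \<Rightarrow> bool" where
  "in_lang k (Equal x y) \<longleftrightarrow> True"
| "in_lang k (Member x y) \<longleftrightarrow> True"
| "in_lang k (Less x y) \<longleftrightarrow> True"
| "in_lang k (Ind j x) \<longleftrightarrow> j < k"
| "in_lang k (Neg p) \<longleftrightarrow> in_lang k p"
| "in_lang k (Conj p q) \<longleftrightarrow> in_lang k p \<and> in_lang k q"
| "in_lang k (Exi x p) \<longleftrightarrow> in_lang k p"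

definition definable_sets ::
  "('a \<Rightarrow> 'a \<Rightarrow> bool) \<Rightarrow> ('a \<Rightarrow> 'a \<Rightarrow> bool) \<Rightarrow> (nat \<Rightarrow> 'a set) \<Rightarrow> 'a set set" where
  "definable_sets E L I = {A. \<exists>p e. A = {a. sat E L I (e(0 := a)) p}}"


definition extensionality :: "('a \<Rightarrow> 'a \<Rightarrow> bool) \<Rightarrow> bool" where
  "extensionality E \<longleftrightarrow> (\<forall>x y. (\<forall>z. E z x \<longleftrightarrow> E z y) \<longrightarrow> x = y)"

definition is_upair :: "('a \<Rightarrow> 'a \<Rightarrow> bool) \<Rightarrow> 'a \<Rightarrow> 'a \<Rightarrow> 'a \<Rightarrow> bool" where
  "is_upair E p x y \<longleftrightarrow> (\<forall>z. E z p \<longleftrightarrow> z = x \<or> z = y)"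

definition pairing :: "('a \<Rightarrow> 'a \<Rightarrow> bool) \<Rightarrow> bool" where
  "pairing E \<longleftrightarrow> (\<forall>x y. \<exists>p. is_upair E p x y)"

definition union_axiom :: "('a \<Rightarrow> 'a \<Rightarrow> bool) \<Rightarrow> bool" where
  "union_axiom E \<longleftrightarrow> (\<forall>x. \<exists>u. \<forall>z. E z u \<longleftrightarrow> (\<exists>y. E y x \<and> E z y))"

definition power_set :: "('a \<Rightarrow> 'a \<Rightarrow> bool) \<Rightarrow> bool" where
  "power_set E \<longleftrightarrow> (\<forall>x. \<exists>p. \<forall>y. E y p \<longleftrightarrow> (\<forall>z. E z y \<longrightarrow> E z x))"

definition infinity :: "('a \<Rightarrow> 'a \<Rightarrow> bool) \<Rightarrow> bool" where
  "infinity E \<longleftrightarrow> (\<exists>x. (\<exists>y. E y x \<and> (\<forall>z. \<not> E z y)) \<and>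
     (\<forall>y. E y x \<longrightarrow> (\<exists>s. E s x \<and> (\<forall>z. E z s \<longleftrightarrow> E z y \<or> z = y))))"

definition foundation :: "('a \<Rightarrow> 'a \<Rightarrow> bool) \<Rightarrow> bool" where
  "foundation E \<longleftrightarrow> (\<forall>x. (\<exists>y. E y x) \<longrightarrow> (\<exists>y. E y x \<and> (\<forall>z. E z y \<longrightarrow> \<not> E z x)))"

definition separation ::
  "nat \<Rightarrow> ('a \<Rightarrow> 'a \<Rightarrow> bool) \<Rightarrow> ('a \<Rightarrow> 'a \<Rightarrow> bool) \<Rightarrow> (nat \<Rightarrow> 'a set) \<Rightarrow> bool" where
  "separation k E L I \<longleftrightarrow> (\<forall>p e a. in_lang k p \<longrightarrow>
     (\<exists>b. \<forall>x. E x b \<longleftrightarrow> E x a \<and> sat E L I (e(0 := x)) p))"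

definition collection ::
  "nat \<Rightarrow> ('a \<Rightarrow> 'a \<Rightarrow> bool) \<Rightarrow> ('a \<Rightarrow> 'a \<Rightarrow> bool) \<Rightarrow> (nat \<Rightarrow> 'a set) \<Rightarrow> bool" where
  "collection k E L I \<longleftrightarrow> (\<forall>p e a. in_lang k p \<longrightarrow>
     (\<forall>x. E x a \<longrightarrow> (\<exists>y. sat E L I (e(0 := x, 1 := y)) p)) \<longrightarrow>
     (\<exists>b. \<forall>x. E x a \<longrightarrow> (\<exists>y. E y b \<and> sat E L I (e(0 := x, 1 := y)) p)))"

definition ZF ::
  "nat \<Rightarrow> ('a \<Rightarrow> 'a \<Rightarrow> bool) \<Rightarrow> ('a \<Rightarrow> 'a \<Rightarrow> bool) \<Rightarrow> (nat \<Rightarrow> 'a set) \<Rightarrow> bool" where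
  "ZF k E L I \<longleftrightarrow> extensionality E \<and> pairing E \<and> union_axiom E \<and> power_set E \<and> infinity E \<and>
     foundation E \<and> separation k E L I \<and> collection k E L I"

text \<open>Every set of pairwise disjoint nonempty sets has a transversal.\<close>

definition choice :: "('a \<Rightarrow> 'a \<Rightarrow> bool) \<Rightarrow> bool" where
  "choice E \<longleftrightarrow> (\<forall>x. (\<forall>y. E y x \<longrightarrow> (\<exists>z. E z y)) \<and>
     (\<forall>y y' z. E y x \<and> E y' x \<and> E z y \<and> E z y' \<longrightarrow> y = y') \<longrightarrow>
     (\<exists>c. \<forall>y. E y x \<longrightarrow> (\<exists>!z. E z y \<and> E z c)))"

definition ZFC ::
  "nat \<Rightarrow> ('a \<Rightarrow> 'a \<Rightarrow> bool) \<Rightarrow> ('a \<Rightarrow> 'a \<Rightarrow> bool) \<Rightarrow> (nat \<Rightarrow> 'a set) \<Rightarrow> bool" where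
  "ZFC k E L I \<longleftrightarrow> ZF k E L I \<and> choice E"

text \<open>Transitive and linearly ordered by membership; under Foundation these are the von Neumann
  ordinals.\<close>

definition is_ord :: "('a \<Rightarrow> 'a \<Rightarrow> bool) \<Rightarrow> 'a \<Rightarrow> bool" where
  "is_ord E x \<longleftrightarrow> (\<forall>y z. E y x \<and> E z y \<longrightarrow> E z x) \<and>
     (\<forall>y z. E y x \<and> E z x \<longrightarrow> E y z \<or> y = z \<or> E z y)"

definition cofinal_in_Ord :: "('a \<Rightarrow> 'a \<Rightarrow> bool) \<Rightarrow> 'a set \<Rightarrow> bool" where
  "cofinal_in_Ord E A \<longleftrightarrow> (\<forall>x\<in>A. is_ord E x) \<and>
     (\<forall>x. is_ord E x \<longrightarrow> (\<exists>y\<in>A. E x y \<or> x = y))"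

definition global_order :: "('a \<Rightarrow> 'a \<Rightarrow> bool) \<Rightarrow> ('a \<Rightarrow> 'a \<Rightarrow> bool) \<Rightarrow> bool" where
  "global_order E L \<longleftrightarrow> irreflp L \<and> transp L \<and> totalp L \<and>
     (\<forall>x. (\<exists>y. E y x) \<longrightarrow> (\<exists>y. E y x \<and> (\<forall>z. E z x \<longrightarrow> y = z \<or> L y z)))"

text \<open>\<open>A\<close> is a class of order indiscernibles for the parameter-free formulae of \<open>in_lang k\<close>.\<close>

definition indiscernibles ::
  "nat \<Rightarrow> ('a \<Rightarrow> 'a \<Rightarrow> bool) \<Rightarrow> ('a \<Rightarrow> 'a \<Rightarrow> bool) \<Rightarrow> (nat \<Rightarrow> 'a set) \<Rightarrow> 'a set \<Rightarrow> bool" where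
  "indiscernibles k E L I A \<longleftrightarrow> (\<forall>p n x y. in_lang k p \<and> free_vars p \<subseteq> {..<n} \<and>
     (\<forall>i<n. x i \<in> A \<and> y i \<in> A) \<and>
     (\<forall>i j. i < j \<and> j < n \<longrightarrow> L (x i) (x j) \<and> L (y i) (y j)) \<longrightarrow>
     (sat E L I x p \<longleftrightarrow> sat E L I y p))"

text \<open>The theories are indexed by \<open>k \<ge> 1\<close>; the value at \<open>0\<close> is a dummy.\<close>

fun ZFI ::
  "nat \<Rightarrow> ('a \<Rightarrow> 'a \<Rightarrow> bool) \<Rightarrow> ('a \<Rightarrow> 'a \<Rightarrow> bool) \<Rightarrow> (nat \<Rightarrow> 'a set) \<Rightarrow> bool" where
  "ZFI 0 E L I \<longleftrightarrow> True"
| "ZFI (Suc 0) E L I \<longleftrightarrow> ZF 1 E L I \<and> global_order E L \<and> cofinal_in_Ord E (I 0) \<and>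
     indiscernibles 0 E L I (I 0)"
| "ZFI (Suc (Suc j)) E L I \<longleftrightarrow> ZFI (Suc j) E L I \<and> ZFC (Suc (Suc j)) E L I \<and>
     cofinal_in_Ord E (I (Suc j)) \<and> indiscernibles (Suc j) E L I (I (Suc j)) \<and>
     I (Suc j) \<subseteq> I j"

definition ZFI_omega ::
  "('a \<Rightarrow> 'a \<Rightarrow> bool) \<Rightarrow> ('a \<Rightarrow> 'a \<Rightarrow> bool) \<Rightarrow> (nat \<Rightarrow> 'a set) \<Rightarrow> bool" where
  "ZFI_omega E L I \<longleftrightarrow> (\<forall>k\<ge>1. ZFI k E L I)"


text \<open>Class-theoretic structures are pairs \<open>(E, X)\<close>, with \<open>X\<close> a family of subsets of the universe
  interpreting the classes, so that extensionality for classes is built in. The formulae of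
  \<open>cfm\<close> are those of class theory without class quantifiers; \<open>ClassMember x c\<close> says that the set
  \<open>x\<close> belongs to the class \<open>c\<close>, the other atomic formulae on classes being eliminable by
  extensionality.\<close>

datatype cfm =
    CEqual nat nat
  | CMember nat nat
  | ClassMember nat nat
  | CNeg cfm
  | CConj cfm cfm
  | CExi nat cfm

primrec csat :: "('a \<Rightarrow> 'a \<Rightarrow> bool) \<Rightarrow> (nat \<Rightarrow> 'a set) \<Rightarrow> (nat \<Rightarrow> 'a) \<Rightarrow> cfm \<Rightarrow> bool" where
  "csat E C e (CEqual x y) \<longleftrightarrow> e x = e y"
| "csat E C e (CMember x y) \<longleftrightarrow> E (e x) (e y)"
| "csat E C e (ClassMember x c) \<longleftrightarrow> e x \<in> C c"
| "csat E C e (CNeg p) \<longleftrightarrow> \<not> csat E C e p"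
| "csat E C e (CConj p q) \<longleftrightarrow> csat E C e p \<and> csat E C e q"
| "csat E C e (CExi x p) \<longleftrightarrow> (\<exists>a. csat E C (e(x := a)) p)"

definition class_comprehension :: "('a \<Rightarrow> 'a \<Rightarrow> bool) \<Rightarrow> 'a set set \<Rightarrow> bool" where
  "class_comprehension E X \<longleftrightarrow>
     (\<forall>p C e. range C \<subseteq> X \<longrightarrow> {a. csat E C (e(0 := a)) p} \<in> X)"

definition is_opair :: "('a \<Rightarrow> 'a \<Rightarrow> bool) \<Rightarrow> 'a \<Rightarrow> 'a \<Rightarrow> 'a \<Rightarrow> bool" where
  "is_opair E p x y \<longleftrightarrow> (\<exists>u v. is_upair E u x x \<and> is_upair E v x y \<and> is_upair E p u v)"

text \<open>The binary relation coded by a class of Kuratowski pairs.\<close>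

definition rel_of :: "('a \<Rightarrow> 'a \<Rightarrow> bool) \<Rightarrow> 'a set \<Rightarrow> 'a \<Rightarrow> 'a \<Rightarrow> bool" where
  "rel_of E R x y \<longleftrightarrow> (\<exists>p\<in>R. is_opair E p x y)"

definition is_relation :: "('a \<Rightarrow> 'a \<Rightarrow> bool) \<Rightarrow> 'a set \<Rightarrow> bool" where
  "is_relation E R \<longleftrightarrow> (\<forall>p\<in>R. \<exists>x y. is_opair E p x y)"

definition is_function :: "('a \<Rightarrow> 'a \<Rightarrow> bool) \<Rightarrow> 'a set \<Rightarrow> bool" where
  "is_function E F \<longleftrightarrow> is_relation E F \<and>
     (\<forall>x y z. rel_of E F x y \<and> rel_of E F x z \<longrightarrow> y = z)"

definition class_foundation :: "('a \<Rightarrow> 'a \<Rightarrow> bool) \<Rightarrow> 'a set set \<Rightarrow> bool" where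
  "class_foundation E X \<longleftrightarrow> (\<forall>A\<in>X. A \<noteq> {} \<longrightarrow> (\<exists>x\<in>A. \<forall>y. E y x \<longrightarrow> y \<notin> A))"

text \<open>\<open>F\<close> may be partial, so Separation for classes is included.\<close>

definition class_replacement :: "('a \<Rightarrow> 'a \<Rightarrow> bool) \<Rightarrow> 'a set set \<Rightarrow> bool" where
  "class_replacement E X \<longleftrightarrow> (\<forall>F\<in>X. is_function E F \<longrightarrow>
     (\<forall>a. \<exists>b. \<forall>y. E y b \<longleftrightarrow> (\<exists>x. E x a \<and> rel_of E F x y)))"

definition global_choice :: "('a \<Rightarrow> 'a \<Rightarrow> bool) \<Rightarrow> 'a set set \<Rightarrow> bool" where
  "global_choice E X \<longleftrightarrow> (\<exists>F\<in>X. is_function E F \<and>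
     (\<forall>x. (\<exists>y. E y x) \<longrightarrow> (\<exists>y. E y x \<and> rel_of E F x y)))"

definition GBC :: "('a \<Rightarrow> 'a \<Rightarrow> bool) \<Rightarrow> 'a set set \<Rightarrow> bool" where
  "GBC E X \<longleftrightarrow> extensionality E \<and> pairing E \<and> union_axiom E \<and> power_set E \<and> infinity E \<and>
     class_foundation E X \<and> class_comprehension E X \<and> class_replacement E X \<and>
     global_choice E X"


text \<open>A tree is a class \<open>T\<close> of nodes with a strict order coded by a class \<open>R\<close> of pairs.\<close>

definition is_tree :: "('a \<Rightarrow> 'a \<Rightarrow> bool) \<Rightarrow> 'a set set \<Rightarrow> 'a set \<Rightarrow> 'a set \<Rightarrow> bool" where
  "is_tree E X T R \<longleftrightarrow> is_relation E R \<and>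
     (\<forall>x y. rel_of E R x y \<longrightarrow> x \<in> T \<and> y \<in> T) \<and>
     (\<forall>x. \<not> rel_of E R x x) \<and>
     (\<forall>x y z. rel_of E R x y \<and> rel_of E R y z \<longrightarrow> rel_of E R x z) \<and>
     (\<forall>x y z. rel_of E R x z \<and> rel_of E R y z \<longrightarrow> rel_of E R x y \<or> x = y \<or> rel_of E R y x) \<and>
     (\<forall>A\<in>X. A \<subseteq> T \<and> A \<noteq> {} \<longrightarrow> (\<exists>x\<in>A. \<forall>y\<in>A. \<not> rel_of E R y x))"

text \<open>Some set \<open>f\<close> of the model is an order isomorphism from the predecessors of \<open>x\<close> onto the
  ordinal \<open>\<alpha>\<close>.\<close>

definition node_height :: "('a \<Rightarrow> 'a \<Rightarrow> bool) \<Rightarrow> 'a set \<Rightarrow> 'a \<Rightarrow> 'a \<Rightarrow> bool" where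
  "node_height E R x \<alpha> \<longleftrightarrow> is_ord E \<alpha> \<and> (\<exists>f. is_function E {p. E p f} \<and>
     (\<forall>y. rel_of E R y x \<longleftrightarrow> (\<exists>\<beta>. rel_of E {p. E p f} y \<beta>)) \<and>
     (\<forall>\<beta>. E \<beta> \<alpha> \<longleftrightarrow> (\<exists>y. rel_of E {p. E p f} y \<beta>)) \<and>
     (\<forall>y z \<beta> \<gamma>. rel_of E {p. E p f} y \<beta> \<and> rel_of E {p. E p f} z \<gamma> \<longrightarrow>
        (y = z \<longleftrightarrow> \<beta> = \<gamma>) \<and> (rel_of E R y z \<longleftrightarrow> E \<beta> \<gamma>)))"

definition is_Ord_tree :: "('a \<Rightarrow> 'a \<Rightarrow> bool) \<Rightarrow> 'a set set \<Rightarrow> 'a set \<Rightarrow> 'a set \<Rightarrow> bool" where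
  "is_Ord_tree E X T R \<longleftrightarrow> is_tree E X T R \<and>
     (\<forall>x\<in>T. \<exists>\<alpha>. node_height E R x \<alpha>) \<and>
     (\<forall>\<alpha>. is_ord E \<alpha> \<longrightarrow> (\<exists>x\<in>T. node_height E R x \<alpha>)) \<and>
     (\<forall>\<alpha>. is_ord E \<alpha> \<longrightarrow> (\<exists>l. \<forall>x. E x l \<longleftrightarrow> x \<in> T \<and> node_height E R x \<alpha>))"

definition is_cofinal_branch :: "('a \<Rightarrow> 'a \<Rightarrow> bool) \<Rightarrow> 'a set \<Rightarrow> 'a set \<Rightarrow> 'a set \<Rightarrow> bool" where
  "is_cofinal_branch E T R B \<longleftrightarrow> B \<subseteq> T \<and>
     (\<forall>x\<in>B. \<forall>y\<in>B. rel_of E R x y \<or> x = y \<or> rel_of E R y x) \<and>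
     (\<forall>x\<in>B. \<forall>y. rel_of E R y x \<longrightarrow> y \<in> B) \<and>
     (\<forall>\<alpha>. is_ord E \<alpha> \<longrightarrow> (\<exists>x\<in>B. node_height E R x \<alpha>))"

definition Ord_weakly_compact :: "('a \<Rightarrow> 'a \<Rightarrow> bool) \<Rightarrow> 'a set set \<Rightarrow> bool" where
  "Ord_weakly_compact E X \<longleftrightarrow>
     (\<forall>T\<in>X. \<forall>R\<in>X. is_Ord_tree E X T R \<longrightarrow> (\<exists>B\<in>X. is_cofinal_branch E T R B))"

end

theory Submission
  imports Defs
begin

text \<open>Let \<open>T\<close> be an \<open>Ord\<close>-tree definable in the language with \<open>I\<^sub>j\<close>, \<open>j < k\<close>, and let \<open>t\<^sub>\<kappa>\<close> be the
  \<open>L\<close>-least node of level \<open>\<kappa>\<close>. For \<open>i \<in> \<kappa> \<in> \<lambda>\<close> in \<open>I\<^sub>k\<close> the predecessors of \<open>t\<^sub>\<kappa>\<close> and \<open>t\<^sub>\<lambda>\<close> on level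
  \<open>i\<close> agree: otherwise, by indiscernibility, they would differ for all such triples, and \<open>\<kappa>\<close> mapped
  to the predecessor of \<open>t\<^sub>\<kappa>\<close> on level \<open>i\<close> would inject a proper class into a set. Hence these
  predecessors generate a cofinal branch, definable with the additional predicate \<open>I\<^sub>k\<close>. Parameters
  are absorbed by quantifying over all parameters of rank at most \<open>i\<close>.\<close>

section \<open>Definable predicates\<close>

text \<open>Indiscernibility speaks only of parameter-free formulae, while a tree of the model comes
  with a parameter \<open>c\<close>. So \<open>c\<close> is replaced by a variable, and the
  statement tested on triples ranges over every parameter of rank at most \<open>i\<close>. It says
  something about \<open>c\<close> once \<open>i\<close> passes the rank of \<open>c\<close>, whence
  the threshold \<open>i0\<close> in the construction of the branch. Quantifying over foreign
  parameters has a price: they may define relations whose values at \<open>i\<close> form no set,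
  and the counting argument breaks down for them. The clause \<open>good\<close> excludes these, and
  the actual tree satisfies it because its levels are sets. Two notions of definability are
  therefore needed: without parameters over \<open>I j\<close> for \<open>j < k\<close>, to apply
  indiscernibility, and with parameters over all predicates, for the classes. Rank bounds require
  \<in>-induction for definable predicates, whereas the axioms give foundation for sets only; this
  is why class foundation comes before the combinatorics.\<close>

primrec ind_ok :: "nat set \<Rightarrow> fm \<Rightarrow> bool" where
  "ind_ok J (Equal x y) \<longleftrightarrow> True"
| "ind_ok J (Member x y) \<longleftrightarrow> True"
| "ind_ok J (Less x y) \<longleftrightarrow> True"
| "ind_ok J (Ind j x) \<longleftrightarrow> j \<in> J"
| "ind_ok J (Neg p) \<longleftrightarrow> ind_ok J p"
| "ind_ok J (Conj p q) \<longleftrightarrow> ind_ok J p \<and> ind_ok J q"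
| "ind_ok J (Exi x p) \<longleftrightarrow> ind_ok J p"

lemma in_lang_iff_ind_ok: "in_lang k p \<longleftrightarrow> ind_ok {..<k} p"
  by (induction p) auto

lemma ind_ok_mono: "ind_ok J p \<Longrightarrow> J \<subseteq> K \<Longrightarrow> ind_ok K p"
  by (induction p) auto

lemma ex_ind_ok: "\<exists>k. ind_ok {..<k} p"
proof (induction p)
  case (Conj p q)
  then obtain k l where "ind_ok {..<k} p" "ind_ok {..<l} q" by blast
  then have "ind_ok {..<max k l} p" "ind_ok {..<max k l} q"
    by (auto elim!: ind_ok_mono)
  then show ?case by auto
qed auto

lemma finite_free_vars: "finite (free_vars p)"
  by (induction p) auto

lemma sat_cong:
  "(\<And>n. n \<in> free_vars p \<Longrightarrow> e n = e' n) \<Longrightarrow> sat E L I e p \<longleftrightarrow> sat E L I e' p"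
proof (induction p arbitrary: e e')
  case (Exi x p)
  have "sat E L I (e(x := a)) p \<longleftrightarrow> sat E L I (e'(x := a)) p" for a
    by (rule Exi.IH) (use Exi.prems in auto)
  then show ?case by simp
next
  case (Conj p q)
  have "sat E L I e p \<longleftrightarrow> sat E L I e' p" "sat E L I e q \<longleftrightarrow> sat E L I e' q"
    by (rule Conj.IH; use Conj.prems in auto)+
  then show ?case by simp
next
  case (Neg p)
  have "sat E L I e p \<longleftrightarrow> sat E L I e' p"
    by (rule Neg.IH) (use Neg.prems in auto)
  then show ?case by simp
qed auto

text \<open>The map \<open>\<sigma>\<close> need not be injective; capture is avoided by a bound
  variable outside the image of the free variables. The collapse of variables in
  \<open>indiscernible\<close> relies on this generality.\<close>

lemma ex_renamed_formula:
  "\<exists>q. free_vars q \<subseteq> \<sigma> ` free_vars p \<and> (\<forall>J. ind_ok J p \<longrightarrow> ind_ok J q) \<and>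
     (\<forall>e. sat E L I e q \<longleftrightarrow> sat E L I (\<lambda>n. e (\<sigma> n)) p)"
proof (induction p arbitrary: \<sigma>)
  case (Equal x y)
  show ?case by (rule exI[of _ "Equal (\<sigma> x) (\<sigma> y)"]) auto
next
  case (Member x y)
  show ?case by (rule exI[of _ "Member (\<sigma> x) (\<sigma> y)"]) auto
next
  case (Less x y)
  show ?case by (rule exI[of _ "Less (\<sigma> x) (\<sigma> y)"]) auto
next
  case (Ind j x)
  show ?case by (rule exI[of _ "Ind j (\<sigma> x)"]) auto
next
  case (Neg p)
  then obtain q where "free_vars q \<subseteq> \<sigma> ` free_vars p" "\<forall>J. ind_ok J p \<longrightarrow> ind_ok J q"
    "\<forall>e. sat E L I e q \<longleftrightarrow> sat E L I (\<lambda>n. e (\<sigma> n)) p" by blast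
  then show ?case by (intro exI[of _ "Neg q"]) auto
next
  case (Conj p p')
  obtain q where "free_vars q \<subseteq> \<sigma> ` free_vars p" "\<forall>J. ind_ok J p \<longrightarrow> ind_ok J q"
    "\<forall>e. sat E L I e q \<longleftrightarrow> sat E L I (\<lambda>n. e (\<sigma> n)) p" using Conj.IH(1) by blast
  moreover obtain q' where "free_vars q' \<subseteq> \<sigma> ` free_vars p'" "\<forall>J. ind_ok J p' \<longrightarrow> ind_ok J q'"
    "\<forall>e. sat E L I e q' \<longleftrightarrow> sat E L I (\<lambda>n. e (\<sigma> n)) p'" using Conj.IH(2) by blast
  ultimately show ?case by (intro exI[of _ "Conj q q'"]) auto
next
  case (Exi x p)
  have "finite (\<sigma> ` free_vars p)" using finite_free_vars by blast
  then obtain y where y: "y \<notin> \<sigma> ` free_vars p" using ex_new_if_finite[OF infinite_UNIV_nat] by blast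
  obtain q where q: "free_vars q \<subseteq> \<sigma>(x := y) ` free_vars p" "\<forall>J. ind_ok J p \<longrightarrow> ind_ok J q"
    "\<forall>e. sat E L I e q \<longleftrightarrow> sat E L I (\<lambda>n. e ((\<sigma>(x := y)) n)) p" using Exi.IH by blast
  have "sat E L I (e(y := a)) q \<longleftrightarrow> sat E L I ((\<lambda>n. e (\<sigma> n))(x := a)) p" for e a
  proof -
    have "sat E L I (e(y := a)) q \<longleftrightarrow> sat E L I (\<lambda>n. (e(y := a)) ((\<sigma>(x := y)) n)) p"
      using q(3) by blast
    also have "\<dots> \<longleftrightarrow> sat E L I ((\<lambda>n. e (\<sigma> n))(x := a)) p"
      by (rule sat_cong) (use y in auto)
    finally show ?thesis .
  qed
  moreover have "free_vars (Exi y q) \<subseteq> \<sigma> ` free_vars (Exi x p)"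
    using q(1) by auto
  ultimately show ?case using q(2) by (intro exI[of _ "Exi y q"]) auto
qed

text \<open>Definability without parameters, stated for HOL predicates on environments so that
  formulae need not be written by hand. A set \<open>J\<close> of indices covers both
  \<open>{..<k}\<close>, a language with known indiscernibles, and \<open>UNIV\<close>.\<close>

definition def0 ::
  "('a \<Rightarrow> 'a \<Rightarrow> bool) \<Rightarrow> ('a \<Rightarrow> 'a \<Rightarrow> bool) \<Rightarrow> (nat \<Rightarrow> 'a set) \<Rightarrow> nat set \<Rightarrow> ((nat \<Rightarrow> 'a) \<Rightarrow> bool) \<Rightarrow> bool"
  where "def0 E L I J P \<longleftrightarrow> (\<exists>p. ind_ok J p \<and> (\<forall>e. sat E L I e p \<longleftrightarrow> P e))"

lemma def0_rename:
  assumes "def0 E L I J P" shows "def0 E L I J (\<lambda>e. P (\<lambda>n. e (\<sigma> n)))"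
proof -
  obtain p where p: "ind_ok J p" "\<forall>e. sat E L I e p \<longleftrightarrow> P e" using assms unfolding def0_def by blast
  obtain q where "\<forall>J. ind_ok J p \<longrightarrow> ind_ok J q"
    "\<forall>e. sat E L I e q \<longleftrightarrow> sat E L I (\<lambda>n. e (\<sigma> n)) p" using ex_renamed_formula by blast
  then show ?thesis unfolding def0_def using p by (intro exI[of _ q]) auto
qed

lemma def0_neg: "def0 E L I J P \<Longrightarrow> def0 E L I J (\<lambda>e. \<not> P e)"
  unfolding def0_def by (metis ind_ok.simps(5) sat.simps(5))

lemma def0_conj: "def0 E L I J P \<Longrightarrow> def0 E L I J Q \<Longrightarrow> def0 E L I J (\<lambda>e. P e \<and> Q e)"
  unfolding def0_def by (metis ind_ok.simps(6) sat.simps(6))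

text \<open>Quantifiers are handled in de Bruijn style: the bound variable becomes entry \<open>0\<close> of the
  environment and all other entries are shifted, so that closure rules can be applied to
  ordinary HOL formulas by resolution.\<close>

lemma def0_ex:
  assumes "def0 E L I J (\<lambda>e. Q (\<lambda>n. e (Suc n)) (e 0))"
  shows "def0 E L I J (\<lambda>e. \<exists>z. Q e z)"
proof -
  obtain p where p: "ind_ok J p" "\<forall>e. sat E L I e p \<longleftrightarrow> Q (\<lambda>n. e (Suc n)) (e 0)"
    using assms unfolding def0_def by blast
  have "def0 E L I J (\<lambda>e. \<exists>z. Q (\<lambda>n. e (Suc n)) z)"
    unfolding def0_def using p by (intro exI[of _ "Exi 0 p"]) auto
  from def0_rename[OF this, of "\<lambda>n. n - 1"] show ?thesis by simp
qed

lemma def0_eq: "def0 E L I J (\<lambda>e. e m = e n)"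
  unfolding def0_def by (rule exI[of _ "Equal m n"]) simp

lemma def0_mem: "def0 E L I J (\<lambda>e. E (e m) (e n))"
  unfolding def0_def by (rule exI[of _ "Member m n"]) simp

lemma def0_less: "def0 E L I J (\<lambda>e. L (e m) (e n))"
  unfolding def0_def by (rule exI[of _ "Less m n"]) simp

lemma def0_ind: "j \<in> J \<Longrightarrow> def0 E L I J (\<lambda>e. e m \<in> I j)"
  unfolding def0_def by (rule exI[of _ "Ind j m"]) simp

lemma def0_disj: "def0 E L I J P \<Longrightarrow> def0 E L I J Q \<Longrightarrow> def0 E L I J (\<lambda>e. P e \<or> Q e)"
  using def0_neg[OF def0_conj[OF def0_neg def0_neg], of E L I J P Q] by simp

lemma def0_iff: "def0 E L I J P \<Longrightarrow> def0 E L I J Q \<Longrightarrow> def0 E L I J (\<lambda>e. P e \<longleftrightarrow> Q e)"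
  unfolding iff_conv_conj_imp imp_conv_disj
  by (intro def0_conj def0_disj def0_neg)

lemma def0_all:
  "def0 E L I J (\<lambda>e. Q (\<lambda>n. e (Suc n)) (e 0)) \<Longrightarrow> def0 E L I J (\<lambda>e. \<forall>z. Q e z)"
  using def0_neg[OF def0_ex[OF def0_neg], of E L I J Q] by simp

lemma def0_opair: "def0 E L I J (\<lambda>e. is_opair E (e l) (e m) (e n))"
  unfolding is_opair_def is_upair_def
  by (intro def0_ex def0_all def0_conj def0_disj def0_iff def0_eq def0_mem)

lemma is_opair_inject: "is_opair E p x y \<Longrightarrow> is_opair E p x' y' \<Longrightarrow> x = x' \<and> y = y'"
  unfolding is_opair_def is_upair_def by metis

section \<open>Models of the theory, and definability with parameters\<close>

locale zfi_model =
  fixes E L :: "'a \<Rightarrow> 'a \<Rightarrow> bool" and I :: "nat \<Rightarrow> 'a set"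
  assumes ZFI: "ZFI_omega E L I"
begin

lemma ZFI_Suc: "ZFI (Suc k) E L I"
  using ZFI unfolding ZFI_omega_def by simp

lemma ZF_Suc: "ZF (Suc k) E L I"
  using ZFI_Suc[of k] by (cases k) (auto simp: ZFC_def)

lemma cofinal_I: "cofinal_in_Ord E (I k)"
  using ZFI_Suc[of k] by (cases k) auto

lemma indiscernibles_I: "indiscernibles k E L I (I k)"
  using ZFI_Suc[of k] by (cases k) auto

lemma global_order: "global_order E L"
  using ZFI_Suc[of 0] by simp

lemma basic_axioms:
  "extensionality E" "pairing E" "union_axiom E" "power_set E" "infinity E" "foundation E"
  using ZF_Suc[of 0] unfolding ZF_def by blast+

lemma ex_upair: "\<exists>p. is_upair E p x y"
  using basic_axioms(2) unfolding pairing_def by blast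

lemma ex_opair: "\<exists>p. is_opair E p x y"
  unfolding is_opair_def using ex_upair by metis

text \<open>Since finitely many parameters can be packed into one Kuratowski tuple, a single
  parameter \<open>c\<close> in entry \<open>0\<close> is enough.\<close>

definition defn :: "nat set \<Rightarrow> bool \<Rightarrow> ((nat \<Rightarrow> 'a) \<Rightarrow> bool) \<Rightarrow> bool" where
  "defn J b P \<longleftrightarrow>
     (if b then \<exists>Q c. def0 E L I J Q \<and> P = (\<lambda>e. Q (case_nat c e)) else def0 E L I J P)"

lemma defn_TrueI: "def0 E L I J Q \<Longrightarrow> (\<And>e. P e \<longleftrightarrow> Q (case_nat c e)) \<Longrightarrow> defn J True P"
  unfolding defn_def by auto

lemma defn_TrueE:
  assumes "defn J True P"
  obtains Q c where "def0 E L I J Q" "\<And>e. P e \<longleftrightarrow> Q (case_nat c e)"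
  using assms unfolding defn_def by auto

definition trm :: "bool \<Rightarrow> ((nat \<Rightarrow> 'a) \<Rightarrow> 'a) \<Rightarrow> bool" where
  "trm b t \<longleftrightarrow> (\<exists>n. t = (\<lambda>e. e n)) \<or> b \<and> (\<exists>c. t = (\<lambda>_. c))"

lemma trm_var: "trm b (\<lambda>e. e n)"
  unfolding trm_def by blast

lemma trm_const: "trm True (\<lambda>_. c)"
  unfolding trm_def by blast

lemma trm_shift: "trm b t \<Longrightarrow> trm b (\<lambda>e. t (\<lambda>n. e (Suc n)))"
  unfolding trm_def by auto

lemmas trm_intros = trm_var trm_const

lemma defn_def0:
  assumes "def0 E L I J P" shows "defn J b P"
proof (cases b)
  case True
  have "def0 E L I J (\<lambda>e. P (\<lambda>n. e (Suc n)))" using def0_rename[OF assms, of Suc] .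
  then have "defn J True P" by (rule defn_TrueI) simp
  then show ?thesis using True by simp
qed (use assms in \<open>simp add: defn_def\<close>)

lemma defn_neg:
  assumes "defn J b P" shows "defn J b (\<lambda>e. \<not> P e)"
proof (cases b)
  case True
  obtain Q c where Q: "def0 E L I J Q" "\<And>e. P e \<longleftrightarrow> Q (case_nat c e)"
    using assms True by (auto elim: defn_TrueE)
  have "defn J True (\<lambda>e. \<not> P e)" by (rule defn_TrueI[OF def0_neg[OF Q(1)]]) (simp add: Q(2))
  then show ?thesis using True by simp
next
  case False
  then show ?thesis using assms def0_neg[of E L I J P] by (simp only: defn_def if_False simp_thms)
qed

lemma defn_conj:
  assumes "defn J b P" "defn J b P'" shows "defn J b (\<lambda>e. P e \<and> P' e)"
proof (cases b)
  case True
  obtain Q c where Q: "def0 E L I J Q" "\<And>e. P e \<longleftrightarrow> Q (case_nat c e)"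
    using assms(1) True by (auto elim: defn_TrueE)
  obtain Q' c' where Q': "def0 E L I J Q'" "\<And>e. P' e \<longleftrightarrow> Q' (case_nat c' e)"
    using assms(2) True by (auto elim: defn_TrueE)
  obtain d where d: "is_opair E d c c'" using ex_opair by blast
  \<comment> \<open>Entry \<open>0\<close> now holds the pair of both parameters, which
    \<open>?S\<close> unpacks. Under the two quantifiers \<open>y\<close> and \<open>x\<close> take
    entries \<open>0\<close> and \<open>1\<close> and the pair takes entry \<open>2\<close>, whence
    the triple \<open>Suc\<close> below.\<close>
  let ?S = "\<lambda>e. \<exists>x y. is_opair E (e 0) x y \<and> Q (case_nat x (\<lambda>n. e (Suc n))) \<and>
    Q' (case_nat y (\<lambda>n. e (Suc n)))"
  have "(\<lambda>e. Q (case_nat (e (Suc 0)) (\<lambda>n. e (Suc (Suc (Suc n)))))) =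
      (\<lambda>e. Q (\<lambda>n. e (case_nat (Suc 0) (\<lambda>n. Suc (Suc (Suc n))) n)))"
    by (rule ext, rule arg_cong[where f = Q]) (auto split: nat.split)
  then have 1: "def0 E L I J (\<lambda>e. Q (case_nat (e (Suc 0)) (\<lambda>n. e (Suc (Suc (Suc n))))))"
    using def0_rename[OF Q(1)] by simp
  have "(\<lambda>e. Q' (case_nat (e 0) (\<lambda>n. e (Suc (Suc (Suc n)))))) =
      (\<lambda>e. Q' (\<lambda>n. e (case_nat 0 (\<lambda>n. Suc (Suc (Suc n))) n)))"
    by (rule ext, rule arg_cong[where f = Q']) (auto split: nat.split)
  then have 2: "def0 E L I J (\<lambda>e. Q' (case_nat (e 0) (\<lambda>n. e (Suc (Suc (Suc n))))))"
    using def0_rename[OF Q'(1)] by simp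
  have "def0 E L I J ?S"
    by (intro def0_ex def0_conj def0_opair 1 2)
  moreover have "P e \<and> P' e \<longleftrightarrow> ?S (case_nat d e)" for e
  proof -
    have "?S (case_nat d e) \<longleftrightarrow> (\<exists>x y. is_opair E d x y \<and> Q (case_nat x e) \<and> Q' (case_nat y e))"
      by simp
    also have "\<dots> \<longleftrightarrow> Q (case_nat c e) \<and> Q' (case_nat c' e)"
      using d is_opair_inject[OF d] by blast
    finally show ?thesis by (simp only: Q(2) Q'(2))
  qed
  ultimately have "defn J True (\<lambda>e. P e \<and> P' e)" by (rule defn_TrueI)
  then show ?thesis using True by simp
next
  case False
  then show ?thesis using assms def0_conj[of E L I J P P'] by (simp only: defn_def if_False simp_thms)
qed

lemma defn_ex:
  assumes "defn J b (\<lambda>e. R (\<lambda>n. e (Suc n)) (e 0))"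
  shows "defn J b (\<lambda>e. \<exists>z. R e z)"
proof (cases b)
  case True
  obtain Q c where Q: "def0 E L I J Q" "\<And>e. R (\<lambda>n. e (Suc n)) (e 0) \<longleftrightarrow> Q (case_nat c e)"
    using assms True by (auto elim: defn_TrueE)
  have R: "R e z \<longleftrightarrow> Q (case_nat c (case_nat z e))" for e z
    using Q(2)[of "case_nat z e"] by simp
  let ?S = "\<lambda>e. \<exists>z. Q (case_nat (e 0) (case_nat z (\<lambda>n. e (Suc n))))"
  have "(\<lambda>e. Q (case_nat (e (Suc 0)) (case_nat (e 0) (\<lambda>n. e (Suc (Suc n)))))) =
      (\<lambda>e. Q (\<lambda>n. e (case_nat (Suc 0) (case_nat 0 (\<lambda>n. Suc (Suc n))) n)))"
    by (rule ext, rule arg_cong[where f = Q]) (auto split: nat.split)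
  then have "def0 E L I J (\<lambda>e. Q (case_nat (e (Suc 0)) (case_nat (e 0) (\<lambda>n. e (Suc (Suc n))))))"
    using def0_rename[OF Q(1)] by simp
  then have "def0 E L I J ?S" by (intro def0_ex)
  then have "defn J True (\<lambda>e. \<exists>z. R e z)" by (rule defn_TrueI) (simp add: R)
  then show ?thesis using True by simp
next
  case False
  then show ?thesis using assms def0_ex[of E L I J R] by (simp only: defn_def if_False simp_thms)
qed

lemma defn_disj: "defn J b P \<Longrightarrow> defn J b Q \<Longrightarrow> defn J b (\<lambda>e. P e \<or> Q e)"
  using defn_neg[OF defn_conj[OF defn_neg defn_neg], of J b P Q] by simp

lemma defn_imp: "defn J b P \<Longrightarrow> defn J b Q \<Longrightarrow> defn J b (\<lambda>e. P e \<longrightarrow> Q e)"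
  unfolding imp_conv_disj by (intro defn_disj defn_neg)

lemma defn_iff: "defn J b P \<Longrightarrow> defn J b Q \<Longrightarrow> defn J b (\<lambda>e. P e \<longleftrightarrow> Q e)"
  unfolding iff_conv_conj_imp by (intro defn_conj defn_imp)

lemma defn_all:
  "defn J b (\<lambda>e. Q (\<lambda>n. e (Suc n)) (e 0)) \<Longrightarrow> defn J b (\<lambda>e. \<forall>z. Q e z)"
  using defn_neg[OF defn_ex[OF defn_neg], of J b Q] by simp

text \<open>Reduces to \<open>\<exists>z. z = t e \<and> P e z\<close>, so formulae need no
  substitution operation. The \<open>defn_app\<close> rules built on it let a notion be shown
  definable once, at variables, and then be used at any \<open>trm\<close>.\<close>

lemma defn_subst:
  assumes "defn J b (\<lambda>e. P (\<lambda>n. e (Suc n)) (e 0))" "trm b t"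
  shows "defn J b (\<lambda>e. P e (t e))"
proof -
  have "defn J b (\<lambda>e. e 0 = t (\<lambda>n. e (Suc n)))"
  proof (cases "\<exists>n. t = (\<lambda>e. e n)")
    case True
    then show ?thesis using defn_def0[OF def0_eq] by auto
  next
    case False
    then obtain c where c: "b" "t = (\<lambda>_. c)" using assms(2) unfolding trm_def by auto
    have "defn J True (\<lambda>e. e 0 = c)"
      by (rule defn_TrueI[OF def0_eq[of E L I J "Suc 0" 0]]) simp
    then show ?thesis using c by simp
  qed
  then have "defn J b (\<lambda>e. \<exists>z. z = t e \<and> P e z)"
    by (intro defn_ex defn_conj assms(1))
  then show ?thesis by simp
qed

lemma defn_app1: "defn J b (\<lambda>e. P (e 0)) \<Longrightarrow> trm b t \<Longrightarrow> defn J b (\<lambda>e. P (t e))"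
  by (rule defn_subst[where P = "\<lambda>_. P"])

lemma defn_rename:
  assumes "defn J b P" shows "defn J b (\<lambda>e. P (\<lambda>n. e (\<sigma> n)))"
proof (cases b)
  case True
  obtain Q c where Q: "def0 E L I J Q" "\<And>e. P e \<longleftrightarrow> Q (case_nat c e)"
    using assms True by (auto elim: defn_TrueE)
  have *: "case_nat c (\<lambda>n. e (\<sigma> n)) = (\<lambda>n. case_nat c e (case_nat 0 (\<lambda>n. Suc (\<sigma> n)) n))" for e
    by (auto split: nat.split)
  have "defn J True (\<lambda>e. P (\<lambda>n. e (\<sigma> n)))"
    by (rule defn_TrueI[OF def0_rename[OF Q(1)]]) (simp only: Q(2) *)
  then show ?thesis using True by simp
next
  case False
  then show ?thesis using assms def0_rename[of E L I J P \<sigma>] by (simp only: defn_def if_False simp_thms)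
qed

lemma defn_app2:
  assumes "defn J b (\<lambda>e. P (e 0) (e 1))" "trm b t" "trm b s"
  shows "defn J b (\<lambda>e. P (t e) (s e))"
proof (rule defn_subst[where P = "\<lambda>e z. P z (s e)" and t = t, OF defn_subst[where P = "\<lambda>e z. P (e 0) z"]])
  \<comment> \<open>The renaming \<open>1 - n\<close> swaps entries \<open>0\<close> and
    \<open>1\<close>. It sends all later entries to \<open>0\<close>, which is harmless since
    \<open>P\<close> reads only these two.\<close>
  show "defn J b (\<lambda>e. P (e (Suc 0)) (e 0))"
    using defn_rename[OF assms(1), of "\<lambda>n. 1 - n"] by simp
  show "trm b (\<lambda>e. s (\<lambda>n. e (Suc n)))" by (rule trm_shift[OF assms(3)])
qed (rule assms)

lemma defn_app3:
  assumes "defn J b (\<lambda>e. P (e 0) (e 1) (e 2))" "trm b t" "trm b s" "trm b r"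
  shows "defn J b (\<lambda>e. P (t e) (s e) (r e))"
proof -
  have "defn J b (\<lambda>e. P (e (Suc (Suc 0))) (e (Suc 0)) (e 0))"
    using defn_rename[OF assms(1), of "\<lambda>n. 2 - n"] by (simp add: numeral_2_eq_2)
  then have "defn J b (\<lambda>e. P (e (Suc 0)) (e 0) (r (\<lambda>n. e (Suc (Suc n)))))"
    by (rule defn_subst[where P = "\<lambda>e z. P (e (Suc 0)) (e 0) z"])
      (rule trm_shift[OF trm_shift[OF assms(4)]])
  then have "defn J b (\<lambda>e. P (e 0) (s (\<lambda>n. e (Suc n))) (r (\<lambda>n. e (Suc n))))"
    by (rule defn_subst[where P = "\<lambda>e z. P (e 0) z (r (\<lambda>n. e (Suc n)))"])
      (rule trm_shift[OF assms(3)])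
  then show ?thesis by (rule defn_subst[where P = "\<lambda>e z. P z (s e) (r e)"]) (rule assms)
qed

lemma defn_eq: "trm b t \<Longrightarrow> trm b s \<Longrightarrow> defn J b (\<lambda>e. t e = s e)"
  by (rule defn_app2[where P = "(=)", OF defn_def0[OF def0_eq]])

lemma defn_mem: "trm b t \<Longrightarrow> trm b s \<Longrightarrow> defn J b (\<lambda>e. E (t e) (s e))"
  by (rule defn_app2[where P = E, OF defn_def0[OF def0_mem]])

lemma defn_less: "trm b t \<Longrightarrow> trm b s \<Longrightarrow> defn J b (\<lambda>e. L (t e) (s e))"
  by (rule defn_app2[where P = L, OF defn_def0[OF def0_less]])

lemma defn_ind: "j \<in> J \<Longrightarrow> trm b t \<Longrightarrow> defn J b (\<lambda>e. t e \<in> I j)"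
  by (rule defn_app1[where P = "\<lambda>x. x \<in> I j"]) (intro defn_def0 def0_ind)

lemma defn_opair:
  "trm b t \<Longrightarrow> trm b s \<Longrightarrow> trm b r \<Longrightarrow> defn J b (\<lambda>e. is_opair E (t e) (s e) (r e))"
  by (rule defn_app3[where P = "is_opair E", OF defn_def0[OF def0_opair]])

lemmas defn_intros = defn_neg defn_conj defn_disj defn_imp defn_iff defn_all defn_ex
  defn_eq defn_mem defn_less defn_opair

text \<open>Brings an arbitrary environment into the one-parameter form: \<open>\<tau>\<close> maps
  each variable to an entry or a constant, and the finitely many constants met in \<open>p\<close>
  are packed along the induction.\<close>

lemma defn_sat:
  "(\<And>n. trm True (\<tau> n)) \<Longrightarrow> defn UNIV True (\<lambda>e. sat E L I (\<lambda>n. \<tau> n e) p)"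
proof (induction p arbitrary: \<tau>)
  case (Exi x p)
  have "defn UNIV True (\<lambda>e. sat E L I (\<lambda>n. (if n = x then (\<lambda>e. e 0) else (\<lambda>e. \<tau> n (\<lambda>n. e (Suc n)))) e) p)"
    by (rule Exi.IH) (auto intro: trm_var trm_shift Exi.prems)
  moreover have "(\<lambda>n. (if n = x then (\<lambda>e. e 0) else (\<lambda>e. \<tau> n (\<lambda>n. e (Suc n)))) e) =
      (\<lambda>n. \<tau> n (\<lambda>n. e (Suc n)))(x := e 0)" for e
    by auto
  ultimately show ?case unfolding sat.simps by (intro defn_ex) simp
qed (simp_all only: sat.simps, (intro defn_intros defn_ind; simp)+)

text \<open>The collection scheme reserves variables \<open>0\<close> and \<open>1\<close>, so the
  parameter moves to variable \<open>2\<close>; \<open>case_nat 2 id\<close> redirects entry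
  \<open>0\<close> there and shifts the other entries back.\<close>

lemma defn_UNIV_iff_sat:
  assumes "defn UNIV True (\<lambda>e. P (e 0) (e 1))"
  shows "\<exists>p e. \<forall>x y. P x y \<longleftrightarrow> sat E L I (e(0 := x, 1 := y)) p"
proof -
  obtain Q c where Q: "def0 E L I UNIV Q" "\<And>e. P (e 0) (e 1) \<longleftrightarrow> Q (case_nat c e)"
    using assms by (auto elim: defn_TrueE)
  have "def0 E L I UNIV (\<lambda>e. Q (\<lambda>n. e (case_nat 2 id n)))"
    using def0_rename[OF Q(1)] .
  then obtain p where p: "\<forall>e. sat E L I e p \<longleftrightarrow> Q (\<lambda>n. e (case_nat 2 id n))"
    unfolding def0_def by blast
  let ?e = "(\<lambda>_. undefined)(2 := c)"
  have "P x y \<longleftrightarrow> sat E L I (?e(0 := x, 1 := y)) p" for x y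
  proof -
    have "(\<lambda>n. (?e(0 := x, 1 := y)) (case_nat 2 id n)) = case_nat c (?e(0 := x, 1 := y))"
      by (auto split: nat.split)
    then show ?thesis using p Q(2)[of "?e(0 := x, 1 := y)"] by simp
  qed
  then show ?thesis by blast
qed

section \<open>Definable classes, with separation and collection for them\<close>

abbreviation "X \<equiv> definable_sets E L I"

lemma definable_sets_iff: "A \<in> X \<longleftrightarrow> defn UNIV True (\<lambda>e. e 0 \<in> A)"
proof
  assume "A \<in> X"
  then obtain p e where A: "A = {a. sat E L I (e(0 := a)) p}" unfolding definable_sets_def by blast
  have "defn UNIV True (\<lambda>e'. sat E L I (\<lambda>n. (if n = 0 then (\<lambda>e'. e' 0) else (\<lambda>_. e n)) e') p)"
    by (rule defn_sat) (auto intro: trm_var trm_const)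
  moreover have "(\<lambda>e'. sat E L I (\<lambda>n. (if n = 0 then (\<lambda>e'. e' 0) else (\<lambda>_. e n)) e') p) =
      (\<lambda>e'. e' 0 \<in> A)"
    unfolding A mem_Collect_eq by (rule ext, rule sat_cong) simp
  ultimately show "defn UNIV True (\<lambda>e. e 0 \<in> A)" by (rule back_subst[where P = "defn UNIV True"])
next
  assume "defn UNIV True (\<lambda>e. e 0 \<in> A)"
  then obtain p e where p: "\<And>x y. x \<in> A \<longleftrightarrow> sat E L I (e(0 := x, 1 := y)) p"
    using defn_UNIV_iff_sat[of "\<lambda>x _. x \<in> A"] by blast
  have "A = {a. sat E L I (e(0 := a)) p}"
  proof -
    have *: "e(0 := a, 1 := e 1) = e(0 := a)" for a by auto
    have "a \<in> A \<longleftrightarrow> sat E L I (e(0 := a)) p" for a using p[of a "e 1"] unfolding * .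
    then show ?thesis by blast
  qed
  then show "A \<in> X" unfolding definable_sets_def by blast
qed

lemma defn_class: "A \<in> X \<Longrightarrow> trm True t \<Longrightarrow> defn UNIV True (\<lambda>e. t e \<in> A)"
  by (rule defn_app1[where P = "\<lambda>x. x \<in> A"]) (simp add: definable_sets_iff)

lemma Collect_definable: "defn UNIV True (\<lambda>e. P (e 0)) \<Longrightarrow> {x. P x} \<in> X"
  by (simp add: definable_sets_iff)

text \<open>A formula mentions finitely many \<open>I j\<close>, so some finite stage of the theory
  covers it. In this way all stages together give separation, and likewise \<open>coll\<close>, for
  every definable predicate.\<close>

lemma sep:
  assumes "defn UNIV True (\<lambda>e. P (e 0))"
  shows "\<exists>b. \<forall>x. E x b \<longleftrightarrow> E x a \<and> P x"
proof -
  obtain p e where A: "{x. P x} = {a. sat E L I (e(0 := a)) p}"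
    using Collect_definable[OF assms] unfolding definable_sets_def by blast
  obtain k where "in_lang k p" using ex_ind_ok in_lang_iff_ind_ok by blast
  then have "in_lang (Suc k) p" unfolding in_lang_iff_ind_ok by (rule ind_ok_mono) auto
  moreover have "separation (Suc k) E L I" using ZF_Suc[of k] unfolding ZF_def by blast
  ultimately have "\<exists>b. \<forall>x. E x b \<longleftrightarrow> E x a \<and> sat E L I (e(0 := x)) p"
    unfolding separation_def by blast
  moreover have "P x \<longleftrightarrow> sat E L I (e(0 := x)) p" for x using A by blast
  ultimately show ?thesis by simp
qed

lemma coll:
  assumes "defn UNIV True (\<lambda>e. P (e 0) (e 1))" "\<And>x. E x a \<Longrightarrow> \<exists>y. P x y"
  shows "\<exists>b. \<forall>x. E x a \<longrightarrow> (\<exists>y. E y b \<and> P x y)"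
proof -
  obtain p e where p: "\<forall>x y. P x y \<longleftrightarrow> sat E L I (e(0 := x, 1 := y)) p"
    using defn_UNIV_iff_sat[OF assms(1)] by blast
  obtain k where "in_lang k p" using ex_ind_ok in_lang_iff_ind_ok by blast
  then have "in_lang (Suc k) p" unfolding in_lang_iff_ind_ok by (rule ind_ok_mono) auto
  moreover have "collection (Suc k) E L I" using ZF_Suc[of k] unfolding ZF_def by blast
  moreover have "\<forall>x. E x a \<longrightarrow> (\<exists>y. sat E L I (e(0 := x, 1 := y)) p)" using assms(2) p by blast
  ultimately have "\<exists>b. \<forall>x. E x a \<longrightarrow> (\<exists>y. E y b \<and> sat E L I (e(0 := x, 1 := y)) p)"
    unfolding collection_def by blast
  then show ?thesis using p by blast
qed

section \<open>Sets and ordinals of the model\<close>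

lemma mem_ext: "(\<And>z. E z x \<longleftrightarrow> E z y) \<Longrightarrow> x = y"
  using basic_axioms(1) unfolding extensionality_def by blast

lemma ex_union: "\<exists>u. \<forall>z. E z u \<longleftrightarrow> (\<exists>y. E y x \<and> E z y)"
  using basic_axioms(3) unfolding union_axiom_def by blast

lemma ex_power: "\<exists>p. \<forall>y. E y p \<longleftrightarrow> (\<forall>z. E z y \<longrightarrow> E z x)"
  using basic_axioms(4) unfolding power_set_def by blast

lemma ex_minimal: "E y x \<Longrightarrow> \<exists>y. E y x \<and> (\<forall>z. E z y \<longrightarrow> \<not> E z x)"
  using basic_axioms(6) unfolding foundation_def by blast

lemma ex_insert: "\<exists>s. \<forall>z. E z s \<longleftrightarrow> E z x \<or> z = y"
proof -
  obtain u where u: "is_upair E u y y" using ex_upair by blast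
  obtain p where p: "is_upair E p x u" using ex_upair by blast
  obtain s where "\<forall>z. E z s \<longleftrightarrow> (\<exists>y. E y p \<and> E z y)" using ex_union by blast
  then have "\<forall>z. E z s \<longleftrightarrow> E z x \<or> z = y" using u p unfolding is_upair_def by auto
  then show ?thesis by blast
qed

lemma no_3_cycle: "E x y \<Longrightarrow> E y z \<Longrightarrow> \<not> E z x"
proof
  assume *: "E x y" "E y z" "E z x"
  obtain p where p: "is_upair E p x y" using ex_upair by blast
  obtain s where s: "\<forall>w. E w s \<longleftrightarrow> E w p \<or> w = z" using ex_insert by blast
  have "E w s \<longleftrightarrow> w = x \<or> w = y \<or> w = z" for w
    using p s unfolding is_upair_def by auto
  then show False using ex_minimal[of x s] * by metis
qed

lemma mem_irrefl: "\<not> E x x"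
  using no_3_cycle by blast

lemma mem_asym: "E x y \<Longrightarrow> \<not> E y x"
proof
  assume *: "E x y" "E y x"
  obtain p where "is_upair E p x y" using ex_upair by blast
  then show False using ex_minimal[of x p] * unfolding is_upair_def by metis
qed

lemma ord_trans: "is_ord E x \<Longrightarrow> E y x \<Longrightarrow> E z y \<Longrightarrow> E z x"
  unfolding is_ord_def by blast

text \<open>Transitivity of \<open>y\<close>: if v \<in> w \<in> y, then v and y are comparable in
  \<open>x\<close>, and v = y or y \<in> v would create a cycle of length 2 or 3.\<close>

lemma ord_mem:
  assumes "is_ord E x" "E y x" shows "is_ord E y"
  using assms no_3_cycle mem_asym unfolding is_ord_def by metis

text \<open>The \<in>-minimal element \<open>m\<close> of the difference of \<open>a\<close> and
  \<open>c\<close> is \<open>c\<close> itself: minimality puts its elements into \<open>c\<close>,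
  and an element of \<open>c\<close> outside \<open>m\<close> would, by comparability in
  \<open>a\<close>, force \<open>m\<close> into \<open>c\<close>.\<close>

lemma ord_psubset_mem:
  assumes "is_ord E a" "is_ord E c" "\<And>z. E z c \<Longrightarrow> E z a" "c \<noteq> a"
  shows "E c a"
proof -
  obtain d where d: "\<forall>x. E x d \<longleftrightarrow> E x a \<and> \<not> E x c"
    using sep[of "\<lambda>x. \<not> E x c" a, OF defn_neg[OF defn_mem[OF trm_var trm_const]]] by blast
  have "\<exists>y. E y d" using d assms(3,4) mem_ext[of c a] by blast
  then obtain m where m: "E m d" "\<And>z. E z m \<Longrightarrow> \<not> E z d" using ex_minimal by blast
  have "m = c"
  proof (rule mem_ext)
    fix z show "E z m \<longleftrightarrow> E z c"
      using m d assms unfolding is_ord_def by metis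
  qed
  then show ?thesis using m d by blast
qed

text \<open>The intersection of \<open>a\<close> and \<open>b\<close> is an ordinal; if it were
  proper in both, it would belong to both and hence to itself.\<close>

lemma ord_linear:
  assumes a: "is_ord E a" and b: "is_ord E b"
  shows "E a b \<or> a = b \<or> E b a"
proof -
  obtain i where i: "\<forall>x. E x i \<longleftrightarrow> E x a \<and> E x b"
    using sep[of "\<lambda>x. E x b" a, OF defn_mem[OF trm_var trm_const]] by blast
  have "is_ord E i" using a b i unfolding is_ord_def by metis
  then have "i = a \<or> E i a" "i = b \<or> E i b"
    using ord_psubset_mem[OF a, of i] ord_psubset_mem[OF b, of i] i by blast+
  then show ?thesis using i mem_irrefl by metis
qed

lemma ex_ord_succ:
  assumes "is_ord E a" shows "\<exists>s. is_ord E s \<and> E a s"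
proof -
  obtain s where s: "\<forall>z. E z s \<longleftrightarrow> E z a \<or> z = a" using ex_insert by blast
  then have "is_ord E s" using assms unfolding is_ord_def by metis
  then show ?thesis using s by blast
qed

lemma defn_ord: "trm b t \<Longrightarrow> defn J b (\<lambda>e. is_ord E (t e))"
  by (rule defn_app1) (unfold is_ord_def, intro defn_intros trm_intros)

text \<open>Burali-Forti: the ordinals in \<open>b\<close> would form an ordinal and thus an element
  of itself.\<close>

lemma no_set_of_ords: "\<not> (\<forall>x. is_ord E x \<longrightarrow> E x b)"
proof
  assume b: "\<forall>x. is_ord E x \<longrightarrow> E x b"
  obtain o' where o': "\<forall>x. E x o' \<longleftrightarrow> E x b \<and> is_ord E x"
    using sep[of "is_ord E" b, OF defn_ord[OF trm_var]] by blast
  then have "is_ord E x \<longleftrightarrow> E x o'" for x using b by blast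
  then have "is_ord E o'" using ord_mem ord_linear unfolding is_ord_def[of E o'] by blast
  then show False using o' b mem_irrefl by blast
qed

text \<open>Otherwise every ordinal is at most some ordinal in \<open>b\<close>, and
  \<open>b\<close> together with its union would contain all ordinals.\<close>

lemma ex_ord_bound: "\<exists>c. is_ord E c \<and> (\<forall>x. E x b \<longrightarrow> is_ord E x \<longrightarrow> E x c)"
proof (rule ccontr)
  assume *: "\<not> ?thesis"
  obtain u where u: "\<forall>z. E z u \<longleftrightarrow> (\<exists>y. E y b \<and> E z y)" using ex_union by blast
  obtain p where p: "is_upair E p b u" using ex_upair by blast
  obtain v where v: "\<forall>z. E z v \<longleftrightarrow> (\<exists>y. E y p \<and> E z y)" using ex_union by blast
  have "E x v" if x: "is_ord E x" for x
  proof -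
    obtain y where "E y b" "is_ord E y" "\<not> E y x" using * x by blast
    then have "E x b \<or> E x u" using ord_linear[OF x] u by blast
    then show ?thesis using p v unfolding is_upair_def by blast
  qed
  then show False using no_set_of_ords by blast
qed

lemma I_ord: "x \<in> I k \<Longrightarrow> is_ord E x"
  using cofinal_I unfolding cofinal_in_Ord_def by blast

lemma ex_I_above:
  assumes "is_ord E x" shows "\<exists>y\<in>I k. E x y"
proof -
  \<comment> \<open>Cofinality offers only \<open>\<in>\<close> or equality; passing to a successor
    makes it strict.\<close>
  obtain s where "is_ord E s" "E x s" using ex_ord_succ[OF assms] by blast
  then show ?thesis using cofinal_I[of k] ord_trans unfolding cofinal_in_Ord_def by metis
qed

lemma ex_I_above2:
  assumes "is_ord E x" "is_ord E y" shows "\<exists>z\<in>I k. E x z \<and> E y z"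
  using ord_linear[OF assms] ex_I_above[OF assms(1), of k] ex_I_above[OF assms(2), of k]
    ord_trans I_ord by metis

lemma ex_L_least: "E y x \<Longrightarrow> \<exists>y. E y x \<and> (\<forall>z. E z x \<longrightarrow> y = z \<or> L y z)"
  using global_order unfolding global_order_def by blast

lemma L_asym: "L x y \<Longrightarrow> \<not> L y x"
  using global_order unfolding global_order_def irreflp_def transp_def by blast

lemma L_total: "L x y \<or> x = y \<or> L y x"
  using global_order unfolding global_order_def totalp_on_def by blast

lemma L_trans: "L x y \<Longrightarrow> L y z \<Longrightarrow> L x z"
  using global_order unfolding global_order_def transp_def by blast

section \<open>Set-sized relations\<close>

text \<open>Counterpart of \<open>rel_of\<close> for sets: a relation \<open>f\<close> inside the
  model can be quantified over in formulae.\<close>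

definition frel :: "'a \<Rightarrow> 'a \<Rightarrow> 'a \<Rightarrow> bool" where
  "frel f x y \<longleftrightarrow> (\<exists>p. E p f \<and> is_opair E p x y)"

lemma rel_of_Collect_mem: "rel_of E {p. E p f} x y \<longleftrightarrow> frel f x y"
  unfolding rel_of_def frel_def by blast

lemma defn_frel: "trm b t \<Longrightarrow> trm b s \<Longrightarrow> trm b r \<Longrightarrow> defn J b (\<lambda>e. frel (t e) (s e) (r e))"
  by (rule defn_app3) (unfold frel_def, intro defn_intros trm_intros)

lemma ex_frel_insert: "\<exists>g. \<forall>x y. frel g x y \<longleftrightarrow> frel f x y \<or> x = a \<and> y = b"
proof -
  obtain p where p: "is_opair E p a b" using ex_opair by blast
  obtain g where g: "\<forall>z. E z g \<longleftrightarrow> E z f \<or> z = p" using ex_insert by blast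
  have "frel g x y \<longleftrightarrow> frel f x y \<or> x = a \<and> y = b" for x y
    unfolding frel_def using g p is_opair_inject[OF p, of x y] by auto
  then show ?thesis by blast
qed

lemma ex_frel_union: "\<exists>g. \<forall>x y. frel g x y \<longleftrightarrow> (\<exists>f. E f s \<and> frel f x y)"
proof -
  obtain g where "\<forall>z. E z g \<longleftrightarrow> (\<exists>y. E y s \<and> E z y)" using ex_union by blast
  then have "\<forall>x y. frel g x y \<longleftrightarrow> (\<exists>f. E f s \<and> frel f x y)" unfolding frel_def by auto
  then show ?thesis by blast
qed

lemma ex_product: "\<exists>w. \<forall>x y. E x a \<longrightarrow> E y b \<longrightarrow> (\<exists>p. E p w \<and> is_opair E p x y)"
proof -
  have row: "\<exists>w. \<forall>y. E y b \<longrightarrow> (\<exists>p. E p w \<and> is_opair E p x y)" for x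
  proof (rule coll)
    show "defn UNIV True (\<lambda>e. is_opair E (e 1) x (e 0))" by (intro defn_intros trm_intros)
  qed (rule ex_opair)
  have "\<exists>w. \<forall>x. E x a \<longrightarrow> (\<exists>v. E v w \<and> (\<forall>y. E y b \<longrightarrow> (\<exists>p. E p v \<and> is_opair E p x y)))"
    by (rule coll[where P = "\<lambda>x v. \<forall>y. E y b \<longrightarrow> (\<exists>p. E p v \<and> is_opair E p x y)", OF _ row])
      (intro defn_intros trm_intros)
  then obtain w where w:
    "\<forall>x. E x a \<longrightarrow> (\<exists>v. E v w \<and> (\<forall>y. E y b \<longrightarrow> (\<exists>p. E p v \<and> is_opair E p x y)))" by blast
  obtain u where "\<forall>z. E z u \<longleftrightarrow> (\<exists>y. E y w \<and> E z y)" using ex_union by blast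
  then show ?thesis using w by blast
qed

section \<open>Foundation for definable classes\<close>

definition is_empty :: "'a \<Rightarrow> bool" where
  "is_empty x \<longleftrightarrow> (\<forall>z. \<not> E z x)"

definition is_succ :: "'a \<Rightarrow> 'a \<Rightarrow> bool" where
  "is_succ s x \<longleftrightarrow> (\<forall>z. E z s \<longleftrightarrow> E z x \<or> z = x)"

lemma defn_empty: "trm b t \<Longrightarrow> defn J b (\<lambda>e. is_empty (t e))"
  by (rule defn_app1) (unfold is_empty_def, intro defn_intros trm_intros)

lemma defn_succ: "trm b t \<Longrightarrow> trm b s \<Longrightarrow> defn J b (\<lambda>e. is_succ (t e) (s e))"
  by (rule defn_app2) (unfold is_succ_def, intro defn_intros trm_intros)

lemma is_succ_inject: "is_succ s x \<Longrightarrow> is_succ s y \<Longrightarrow> x = y"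
  unfolding is_succ_def using mem_asym by metis

lemma is_succ_fun: "is_succ s x \<Longrightarrow> is_succ t x \<Longrightarrow> s = t"
  unfolding is_succ_def by (rule mem_ext) blast

lemma is_empty_fun: "is_empty x \<Longrightarrow> is_empty y \<Longrightarrow> x = y"
  unfolding is_empty_def by (rule mem_ext) blast

text \<open>\<open>w\<close> consists of those members of one inductive set that lie in every
  inductive set. Induction for a definable \<open>P\<close> follows because separation makes the
  part of \<open>w\<close> satisfying \<open>P\<close> an inductive set.\<close>

lemma ex_omega:
  obtains w where "\<exists>z. E z w \<and> is_empty z" "\<And>n s. E n w \<Longrightarrow> is_succ s n \<Longrightarrow> E s w"
    "\<And>P n. defn UNIV True (\<lambda>e. P (e 0)) \<Longrightarrow> (\<And>z. is_empty z \<Longrightarrow> P z) \<Longrightarrow>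
       (\<And>n s. E n w \<Longrightarrow> P n \<Longrightarrow> is_succ s n \<Longrightarrow> P s) \<Longrightarrow> E n w \<Longrightarrow> P n"
proof -
  define succ_closed where "succ_closed N \<longleftrightarrow>
    (\<forall>z. is_empty z \<longrightarrow> E z N) \<and> (\<forall>n s. E n N \<longrightarrow> is_succ s n \<longrightarrow> E s N)" for N
  have "\<exists>N. (\<exists>y. E y N \<and> is_empty y) \<and> (\<forall>y. E y N \<longrightarrow> (\<exists>s. E s N \<and> is_succ s y))"
    using basic_axioms(5) unfolding infinity_def is_empty_def is_succ_def .
  then obtain N z where N0: "E z N" "is_empty z" "\<forall>y. E y N \<longrightarrow> (\<exists>s. E s N \<and> is_succ s y)"
    by blast
  have N: "succ_closed N"
    unfolding succ_closed_def
  proof (intro conjI allI impI)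
    show "E y N" if "is_empty y" for y using is_empty_fun[OF that N0(2)] N0(1) by simp
    show "E s N" if "E n N" "is_succ s n" for n s using N0(3) that is_succ_fun by blast
  qed
  have "defn UNIV True (\<lambda>e. \<forall>M. succ_closed M \<longrightarrow> E (e 0) M)"
    unfolding succ_closed_def by (intro defn_intros defn_empty defn_succ trm_intros)
  from sep[of "\<lambda>n. \<forall>M. succ_closed M \<longrightarrow> E n M", OF this]
  obtain w where w: "\<forall>n. E n w \<longleftrightarrow> E n N \<and> (\<forall>M. succ_closed M \<longrightarrow> E n M)" by blast
  have sc: "succ_closed M \<Longrightarrow> is_empty z \<Longrightarrow> E z M"
    "succ_closed M \<Longrightarrow> E n M \<Longrightarrow> is_succ s n \<Longrightarrow> E s M" for M z n s
    unfolding succ_closed_def by blast+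
  have ind: "succ_closed w" unfolding succ_closed_def
  proof (intro conjI allI impI)
    show "E z w" if "is_empty z" for z using w N sc(1) that by blast
    show "E s w" if "E n w" "is_succ s n" for n s
      using w[rule_format, of n] w[rule_format, of s] N sc(2)[OF _ _ that(2)] that(1) by blast
  qed
  show thesis
  proof
    show "\<exists>z. E z w \<and> is_empty z" using sc(1)[OF ind N0(2)] N0(2) by blast
    show "E s w" if "E n w" "is_succ s n" for n s
      by (rule sc(2)[OF ind that])
  next
    fix P n
    assume P: "defn UNIV True (\<lambda>e. P (e 0))" "\<And>z. is_empty z \<Longrightarrow> P z"
      "\<And>n s. E n w \<Longrightarrow> P n \<Longrightarrow> is_succ s n \<Longrightarrow> P s" "E n w"
    obtain M where M: "\<forall>x. E x M \<longleftrightarrow> E x w \<and> P x" using sep[OF P(1)] by blast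
    have "succ_closed M" unfolding succ_closed_def
    proof (intro conjI allI impI)
      show "E z M" if "is_empty z" for z using M sc(1)[OF ind] P(2) that by blast
      show "E s M" if "E n M" "is_succ s n" for n s
        using M[rule_format, of n] M[rule_format, of s] P(3)[of n s] sc(2)[OF ind _ that(2)] that
        by blast
    qed
    then show "P n" using w M P(4) by blast
  qed
qed

text \<open>A class without \<open>\<in>\<close>-minimal element is refuted by iterating \<open>x \<mapsto>\<close> the \<open>L\<close>-least element
  of \<open>x \<inter> A\<close> along \<open>\<omega>\<close>: the values form a set without \<open>\<in>\<close>-minimal element.\<close>

lemma class_foundation: "class_foundation E X"
  unfolding class_foundation_def
proof (intro ballI impI, rule ccontr)
  fix A
  assume A: "A \<in> X" "A \<noteq> {}"
  assume no_minimal: "\<not> (\<exists>x\<in>A. \<forall>y. E y x \<longrightarrow> y \<notin> A)"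
  obtain x0 where x0: "x0 \<in> A" using A(2) by blast
  define G where "G z y \<longleftrightarrow> E y z \<and> y \<in> A \<and> (\<forall>v. E v z \<and> v \<in> A \<longrightarrow> y = v \<or> L y v)" for z y
  have defn_G: "trm True t \<Longrightarrow> trm True s \<Longrightarrow> defn UNIV True (\<lambda>e. G (t e) (s e))" for t s
    by (rule defn_app2) (unfold G_def, intro defn_intros defn_class[OF A(1)] trm_intros)
  have ex_G: "\<exists>y. G z y" if "z \<in> A" for z
  proof -
    obtain b where b: "\<forall>x. E x b \<longleftrightarrow> E x z \<and> x \<in> A"
      using sep[of "\<lambda>x. x \<in> A" z, OF defn_class[OF A(1) trm_var]] by blast
    then have "\<exists>y. E y b" using no_minimal that by blast
    then show ?thesis unfolding G_def using ex_L_least b by metis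
  qed
  have G_fun: "G z y \<Longrightarrow> G z y' \<Longrightarrow> y = y'" for z y y'
    unfolding G_def using L_asym by blast
  \<comment> \<open>Such an \<open>f\<close> need not be a function; each of its pairs must only
    come from the start or from an earlier pair. Uniqueness of values is obtained separately, by
    induction on \<open>w\<close>.\<close>
  define steps where "steps f \<longleftrightarrow> (\<forall>m b. frel f m b \<longrightarrow> is_empty m \<and> b = x0 \<or>
    (\<exists>m' b'. is_succ m m' \<and> frel f m' b' \<and> G b' b))" for f
  define app where "app n u \<longleftrightarrow> (\<exists>f. frel f n u \<and> steps f)" for n u
  have defn_app: "trm True t \<Longrightarrow> trm True s \<Longrightarrow> defn UNIV True (\<lambda>e. app (t e) (s e))" for t s
    by (rule defn_app2) (unfold app_def steps_def,
      intro defn_intros defn_G defn_frel defn_succ defn_empty trm_intros)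
  have app_cases: "is_empty n \<and> u = x0 \<or> (\<exists>m b. is_succ n m \<and> app m b \<and> G b u)" if "app n u" for n u
    using that unfolding app_def steps_def by blast
  have app_A: "u \<in> A" if "app n u" for n u
    using app_cases[OF that] x0 unfolding G_def by blast
  have app_0: "app z x0" if "is_empty z" for z
  proof -
    obtain f where "\<forall>x y. frel f x y \<longleftrightarrow> frel z x y \<or> x = z \<and> y = x0" using ex_frel_insert by blast
    moreover have "\<not> frel z x y" for x y using that unfolding is_empty_def frel_def by blast
    ultimately have "frel f x y \<longleftrightarrow> x = z \<and> y = x0" for x y by simp
    then have "frel f z x0 \<and> steps f" unfolding steps_def using that by simp
    then show ?thesis unfolding app_def by blast
  qed
  have app_succ: "app s v" if u: "app n u" and "is_succ s n" "G u v" for n s u v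
  proof -
    obtain f where f: "frel f n u" "steps f" using u unfolding app_def by blast
    obtain g where g: "\<forall>x y. frel g x y \<longleftrightarrow> frel f x y \<or> x = s \<and> y = v" using ex_frel_insert by blast
    have "steps g" unfolding steps_def
    proof (intro allI impI)
      fix m b assume "frel g m b"
      then consider "frel f m b" | "m = s" "b = v" using g by blast
      then show "is_empty m \<and> b = x0 \<or> (\<exists>m' b'. is_succ m m' \<and> frel g m' b' \<and> G b' b)"
      proof cases
        case 1 then show ?thesis using f(2) g unfolding steps_def by blast
      next
        case 2 then show ?thesis using f(1) g that by blast
      qed
    qed
    then show ?thesis unfolding app_def using g by blast
  qed
  obtain w where w: "\<exists>z. E z w \<and> is_empty z" "\<And>n s. E n w \<Longrightarrow> is_succ s n \<Longrightarrow> E s w"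
    "\<And>P n. defn UNIV True (\<lambda>e. P (e 0)) \<Longrightarrow> (\<And>z. is_empty z \<Longrightarrow> P z) \<Longrightarrow>
       (\<And>n s. E n w \<Longrightarrow> P n \<Longrightarrow> is_succ s n \<Longrightarrow> P s) \<Longrightarrow> E n w \<Longrightarrow> P n"
    using ex_omega by blast
  have ex_app: "\<exists>u. app n u" if "E n w" for n
  proof (rule w(3)[of "\<lambda>n. \<exists>u. app n u", OF _ _ _ that])
    show "defn UNIV True (\<lambda>e. \<exists>u. app (e 0) u)" by (intro defn_intros defn_app trm_intros)
  next
    show "\<exists>u. app s u" if "\<exists>u. app n u" "is_succ s n" for n s
      using that app_succ app_A ex_G by blast
  qed (use app_0 in blast)
  have app_fun: "\<forall>u v. app n u \<longrightarrow> app n v \<longrightarrow> u = v" if "E n w" for n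
  proof (rule w(3)[of "\<lambda>n. \<forall>u v. app n u \<longrightarrow> app n v \<longrightarrow> u = v", OF _ _ _ that])
    show "defn UNIV True (\<lambda>e. \<forall>u v. app (e 0) u \<longrightarrow> app (e 0) v \<longrightarrow> u = v)"
      by (intro defn_intros defn_app trm_intros)
  next
    have *: "\<not> (is_empty z \<and> is_succ z m)" for z m unfolding is_empty_def is_succ_def by blast
    show "\<forall>u v. app z u \<longrightarrow> app z v \<longrightarrow> u = v" if "is_empty z" for z
      using that app_cases[of z] * by blast
    show "\<forall>u v. app s u \<longrightarrow> app s v \<longrightarrow> u = v"
      if IH: "\<forall>u v. app n u \<longrightarrow> app n v \<longrightarrow> u = v" and s: "is_succ s n" for n s
    proof (intro allI impI)
      fix u v assume uv: "app s u" "app s v"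
      obtain m b m' b' where "is_succ s m" "app m b" "G b u" "is_succ s m'" "app m' b'" "G b' v"
        using app_cases[OF uv(1)] app_cases[OF uv(2)] * s by metis
      moreover from this have "m = n" "m' = n" using is_succ_inject s by blast+
      ultimately show "u = v" using IH G_fun by metis
    qed
  qed
  have "\<exists>b. \<forall>n. E n w \<longrightarrow> (\<exists>u. E u b \<and> app n u)"
    by (rule coll) (use ex_app in \<open>auto intro: defn_app trm_intros\<close>)
  then obtain b where b: "\<forall>n. E n w \<longrightarrow> (\<exists>u. E u b \<and> app n u)" by blast
  have "defn UNIV True (\<lambda>e. \<exists>n. E n w \<and> app n (e 0))" by (intro defn_intros defn_app trm_intros)
  from sep[of "\<lambda>u. \<exists>n. E n w \<and> app n u", OF this]
  obtain s where s: "\<forall>u. E u s \<longleftrightarrow> E u b \<and> (\<exists>n. E n w \<and> app n u)" by blast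
  have "\<exists>u. E u s" using w(1) b s by blast
  then obtain u where u: "E u s" "\<And>v. E v u \<Longrightarrow> \<not> E v s" using ex_minimal by blast
  obtain n where n: "E n w" "app n u" using u s by blast
  obtain v where v: "G u v" using ex_G app_A n by blast
  obtain m where m: "is_succ m n" using ex_insert unfolding is_succ_def by blast
  have "E m w" "app m v" using w(2) app_succ n m v by blast+
  \<comment> \<open>Collection only placed some value at \<open>m\<close> into \<open>b\<close>;
    uniqueness identifies it with \<open>v\<close>.\<close>
  then have "E v s" using b s app_fun by metis
  then show False using u v unfolding G_def by blast
qed

lemma mem_induct:
  assumes "defn UNIV True (\<lambda>e. P (e 0))" "\<And>x. (\<And>y. E y x \<Longrightarrow> P y) \<Longrightarrow> P x"
  shows "P x"
proof (rule ccontr)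
  assume "\<not> P x"
  have "{x. \<not> P x} \<in> X" by (intro Collect_definable defn_neg assms(1))
  moreover have "{x. \<not> P x} \<noteq> {}" using \<open>\<not> P x\<close> by auto
  ultimately obtain y where "\<not> P y" "\<And>z. E z y \<Longrightarrow> P z"
    using class_foundation[unfolded class_foundation_def, rule_format, of "{x. \<not> P x}"] by auto
  then show False using assms(2)[of y] by simp
qed

section \<open>Bounded rank\<close>

text \<open>\<open>rank_le x \<alpha>\<close> says that \<open>x\<close> has rank at most the ordinal \<open>\<alpha>\<close>; it is witnessed by a
  simulation of \<open>x\<close> by \<open>\<alpha>\<close>, which avoids defining the rank function by recursion.\<close>

definition sim :: "'a \<Rightarrow> bool" where
  "sim f \<longleftrightarrow> (\<forall>x a. frel f x a \<longrightarrow> is_ord E a \<and> (\<forall>y. E y x \<longrightarrow> (\<exists>b. E b a \<and> frel f y b)))"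

definition rank_le :: "'a \<Rightarrow> 'a \<Rightarrow> bool" where
  "rank_le x a \<longleftrightarrow> (\<exists>f. sim f \<and> frel f x a)"

lemma defn_sim: "trm b t \<Longrightarrow> defn J b (\<lambda>e. sim (t e))"
  by (rule defn_app1) (unfold sim_def, intro defn_intros defn_frel defn_ord trm_intros)

lemma defn_rank_le: "trm b t \<Longrightarrow> trm b s \<Longrightarrow> defn J b (\<lambda>e. rank_le (t e) (s e))"
  by (rule defn_app2) (unfold rank_le_def, intro defn_intros defn_frel defn_sim trm_intros)

lemma rank_leD: "rank_le x a \<Longrightarrow> is_ord E a" "rank_le x a \<Longrightarrow> E y x \<Longrightarrow> \<exists>b. E b a \<and> rank_le y b"
  unfolding rank_le_def sim_def by blast+

text \<open>Simulations need not be functional, so the union of simulations collected for the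
  elements of \<open>x\<close>, extended by the pair of \<open>x\<close> and \<open>a\<close>, is
  again a simulation.\<close>

lemma rank_leI:
  assumes a: "is_ord E a" and x: "\<And>y. E y x \<Longrightarrow> \<exists>b. E b a \<and> rank_le y b"
  shows "rank_le x a"
proof -
  have "\<exists>s. \<forall>y. E y x \<longrightarrow> (\<exists>f. E f s \<and> sim f \<and> (\<exists>b. E b a \<and> frel f y b))"
  proof (rule coll)
    show "defn UNIV True (\<lambda>e. sim (e 1) \<and> (\<exists>b. E b a \<and> frel (e 1) (e 0) b))"
      by (intro defn_intros defn_sim defn_frel trm_intros)
    show "\<exists>f. sim f \<and> (\<exists>b. E b a \<and> frel f y b)" if "E y x" for y
      using x[OF that] unfolding rank_le_def by blast
  qed
  then obtain s where s: "\<And>y. E y x \<Longrightarrow> \<exists>f. E f s \<and> sim f \<and> (\<exists>b. E b a \<and> frel f y b)" by blast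
  obtain s' where s': "\<forall>f. E f s' \<longleftrightarrow> E f s \<and> sim f" using sep[OF defn_sim[OF trm_var]] by blast
  obtain g where g: "\<forall>u v. frel g u v \<longleftrightarrow> (\<exists>f. E f s' \<and> frel f u v)" using ex_frel_union by blast
  obtain h where h: "\<forall>u v. frel h u v \<longleftrightarrow> frel g u v \<or> u = x \<and> v = a" using ex_frel_insert by blast
  have gh: "frel h u v" if "frel g u v" for u v using h that by blast
  have "sim h" unfolding sim_def
  proof (intro allI impI)
    fix u v assume "frel h u v"
    then consider f where "E f s'" "frel f u v" | "u = x" "v = a" using h g by blast
    then show "is_ord E v \<and> (\<forall>y. E y u \<longrightarrow> (\<exists>b. E b v \<and> frel h y b))"
    proof cases
      case 1
      then have "sim f" using s' by blast
      then have *: "is_ord E v" "\<And>y. E y u \<Longrightarrow> \<exists>b. E b v \<and> frel f y b"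
        using 1(2) unfolding sim_def by blast+
      have "frel h y b" if "frel f y b" for y b using gh g 1(1) that by blast
      then show ?thesis using * by blast
    next
      case 2
      have "\<exists>b. E b a \<and> frel h y b" if y: "E y x" for y
      proof -
        obtain f b where "E f s" "sim f" "E b a" "frel f y b" using s[OF y] by blast
        moreover from this have "E f s'" using s' by blast
        ultimately show ?thesis using g gh by blast
      qed
      then show ?thesis using 2 a by blast
    qed
  qed
  then show ?thesis unfolding rank_le_def using h by blast
qed

lemma rank_le_mono: "rank_le x a \<Longrightarrow> is_ord E b \<Longrightarrow> E a b \<Longrightarrow> rank_le x b"
  by (rule rank_leI) (use rank_leD(2) ord_trans in blast)+

lemma ex_rank_le: "\<exists>a. rank_le x a"
proof (rule mem_induct[where P = "\<lambda>x. \<exists>a. rank_le x a"])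
  show "defn UNIV True (\<lambda>e. \<exists>a. rank_le (e 0) a)" by (intro defn_intros defn_rank_le trm_intros)
next
  fix x assume IH: "\<And>y. E y x \<Longrightarrow> \<exists>a. rank_le y a"
  obtain b where b: "\<And>y. E y x \<Longrightarrow> \<exists>a. E a b \<and> rank_le y a"
    using coll[of rank_le x, OF defn_rank_le[OF trm_var trm_var] IH] by blast
  obtain c where c: "is_ord E c" "\<And>a. E a b \<Longrightarrow> is_ord E a \<Longrightarrow> E a c" using ex_ord_bound by blast
  have "rank_le x c"
  proof (rule rank_leI[OF c(1)])
    show "\<exists>a. E a c \<and> rank_le y a" if y: "E y x" for y
      using b[OF y] c(2) rank_leD(1) by blast
  qed
  then show "\<exists>a. rank_le x a" by blast
qed

text \<open>Replaces the rank hierarchy: each element of \<open>x\<close> has rank at most some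
  member of \<open>a\<close>, so by induction all of them lie in one set \<open>u\<close>, and
  \<open>x\<close> lies in its power set.\<close>

lemma rank_le_bounded: "\<exists>s. \<forall>x. rank_le x a \<longrightarrow> E x s"
proof (rule mem_induct[where P = "\<lambda>a. \<exists>s. \<forall>x. rank_le x a \<longrightarrow> E x s"])
  show "defn UNIV True (\<lambda>e. \<exists>s. \<forall>x. rank_le x (e 0) \<longrightarrow> E x s)"
    by (intro defn_intros defn_rank_le trm_intros)
next
  fix a assume IH: "\<And>b. E b a \<Longrightarrow> \<exists>s. \<forall>x. rank_le x b \<longrightarrow> E x s"
  have "defn UNIV True (\<lambda>e. \<forall>x. rank_le x (e 0) \<longrightarrow> E x (e 1))"
    by (intro defn_intros defn_rank_le trm_intros)
  from coll[of "\<lambda>b s. \<forall>x. rank_le x b \<longrightarrow> E x s", OF this IH]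
  obtain c where c: "\<And>b. E b a \<Longrightarrow> \<exists>s. E s c \<and> (\<forall>x. rank_le x b \<longrightarrow> E x s)" by blast
  obtain u where u: "\<And>z. E z u \<longleftrightarrow> (\<exists>y. E y c \<and> E z y)" using ex_union by blast
  obtain p where p: "\<And>y. E y p \<longleftrightarrow> (\<forall>z. E z y \<longrightarrow> E z u)" using ex_power by blast
  have "E x p" if x: "rank_le x a" for x
    unfolding p
  proof (intro allI impI)
    fix z assume "E z x"
    then obtain b where "E b a" "rank_le z b" using rank_leD(2)[OF x] by blast
    then show "E z u" unfolding u using c by blast
  qed
  then show "\<exists>s. \<forall>x. rank_le x a \<longrightarrow> E x s" by blast
qed

section \<open>Indiscernibles and coherence\<close>

text \<open>Each \<open>k\<close> in \<open>D\<close> is determined by the subset of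
  \<open>W\<close> that \<open>Q k\<close> cuts out, so collecting the inverse map over the power
  set of \<open>W\<close> yields a set covering \<open>D\<close>.\<close>

lemma bounded_if_separated:
  assumes D: "defn UNIV True (\<lambda>e. D (e 0))" and Q: "defn UNIV True (\<lambda>e. Q (e 0) (e 1))"
    and sepd: "\<And>k l. D k \<Longrightarrow> D l \<Longrightarrow> k \<noteq> l \<Longrightarrow> \<exists>w. E w W \<and> Q k w \<noteq> Q l w"
  shows "\<exists>b. \<forall>k. D k \<longrightarrow> E k b"
proof -
  define H where "H x y \<longleftrightarrow> D y \<and> (\<forall>w. E w W \<longrightarrow> (Q y w \<longleftrightarrow> E w x))" for x y
  obtain pw where pw: "\<And>y. E y pw \<longleftrightarrow> (\<forall>z. E z y \<longrightarrow> E z W)" using ex_power by blast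
  \<comment> \<open>The premise makes the partial inverse total, as \<open>coll\<close> requires a
    witness for every subset.\<close>
  have "\<exists>b. \<forall>x. E x pw \<longrightarrow> (\<exists>y. E y b \<and> ((\<exists>z. H x z) \<longrightarrow> H x y))"
  proof (rule coll)
    show "defn UNIV True (\<lambda>e. (\<exists>z. H (e 0) z) \<longrightarrow> H (e 0) (e 1))"
      unfolding H_def by (intro defn_intros defn_app1[OF D] defn_app2[OF Q] trm_intros)
  qed blast
  then obtain b where b: "\<And>x. E x pw \<Longrightarrow> \<exists>y. E y b \<and> ((\<exists>z. H x z) \<longrightarrow> H x y)" by blast
  have "E k b" if k: "D k" for k
  proof -
    obtain x where x: "\<And>w. E w x \<longleftrightarrow> E w W \<and> Q k w"
      using sep[of "Q k" W, OF defn_app2[OF Q trm_const trm_var]] by blast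
    then have "E x pw" "H x k" unfolding pw H_def using k by auto
    then obtain y where y: "E y b" "H x y" using b by blast
    have "y = k"
    proof (rule ccontr)
      assume "y \<noteq> k"
      then obtain w where "E w W" "Q y w \<noteq> Q k w" using sepd[of y k] y k unfolding H_def by blast
      then show False using y x unfolding H_def by auto
    qed
    then show ?thesis using y by simp
  qed
  then show ?thesis by blast
qed

lemma indiscernible:
  assumes P: "def0 E L I {..<k} P" and dep: "\<And>e e'. (\<And>i. i < n \<Longrightarrow> e i = e' i) \<Longrightarrow> P e = P e'"
    and n: "n > 0" and mem: "\<And>i. i < n \<Longrightarrow> x i \<in> I k \<and> y i \<in> I k"
    and inc: "\<And>i j. i < j \<Longrightarrow> j < n \<Longrightarrow> L (x i) (x j) \<and> L (y i) (y j)"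
  shows "P x = P y"
proof -
  obtain p where p: "ind_ok {..<k} p" "\<And>e. sat E L I e p = P e" using P unfolding def0_def by blast
  \<comment> \<open>Dependence on the first \<open>n\<close> entries is semantic, but the axiom asks
    for free variables below \<open>n\<close>: all later variables are identified with variable
    \<open>n - 1\<close>.\<close>
  obtain q where q: "free_vars q \<subseteq> (\<lambda>m. min m (n - 1)) ` free_vars p" "\<forall>J. ind_ok J p \<longrightarrow> ind_ok J q"
    "\<And>e. sat E L I e q \<longleftrightarrow> sat E L I (\<lambda>m. e (min m (n - 1))) p"
    using ex_renamed_formula[of "\<lambda>m. min m (n - 1)" p E L I] by blast
  have "P e = sat E L I e q" for e
    unfolding q(3) p(2) by (rule dep) (simp add: min_def, use n in linarith)
  moreover have "free_vars q \<subseteq> {..<n}" using q(1) n by auto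
  moreover have "in_lang k q" unfolding in_lang_iff_ind_ok using q(2) p(1) by blast
  ultimately show ?thesis
    using indiscernibles_I[of k, unfolded indiscernibles_def, rule_format, of q n x y] mem inc by simp
qed

lemma indiscernible_mem:
  assumes "a \<in> I k" "b \<in> I k" "L a b" "c \<in> I k" "d \<in> I k" "L c d"
  shows "E a b \<longleftrightarrow> E c d"
proof -
  have "(\<lambda>e. E (e 0) (e 1)) (case_nat a (\<lambda>_. b)) = (\<lambda>e. E (e 0) (e 1)) (case_nat c (\<lambda>_. d))"
    by (rule indiscernible[of k _ 2, OF def0_mem]) (use assms in \<open>auto split: nat.split\<close>)
  then show ?thesis by simp
qed

text \<open>On \<open>I\<^sub>k\<close> the order \<open>L\<close> is either \<open>\<in>\<close> or its converse; in both cases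
  indiscernibility holds for \<open>\<in>\<close>-increasing tuples.\<close>

lemma indiscernible_triples:
  assumes P: "def0 E L I {..<k} (\<lambda>e. P (e 0) (e 1) (e 2))"
    and x: "x \<in> I k" "y \<in> I k" "z \<in> I k" "E x y" "E y z"
    and x': "x' \<in> I k" "y' \<in> I k" "z' \<in> I k" "E x' y'" "E y' z'"
  shows "P x y z = P x' y' z'"
\<comment> \<open>The direction of this one pair carries over to all pairs by
  \<open>indiscernible_mem\<close>; mixed directions would produce a 2-cycle of
  \<open>E\<close>.\<close>
proof (cases "L x y")
  case True
  have L: "L a b" if "a \<in> I k" "b \<in> I k" "E a b" for a b
  proof -
    have "\<not> L b a" using indiscernible_mem[of x k y b a] x True that mem_asym[of a b] by blast
    then show ?thesis using L_total[of a b] that mem_irrefl by blast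
  qed
  have "(\<lambda>e. P (e 0) (e 1) (e 2)) (case_nat x (case_nat y (\<lambda>_. z))) =
      (\<lambda>e. P (e 0) (e 1) (e 2)) (case_nat x' (case_nat y' (\<lambda>_. z')))"
    by (rule indiscernible[of k _ 3, OF P])
      (use x x' L L_trans[OF L[of x y] L[of y z]] L_trans[OF L[of x' y'] L[of y' z']]
        in \<open>auto split: nat.split\<close>)
  then show ?thesis by (simp add: numeral_2_eq_2)
next
  case False
  then have yx: "L y x" using L_total[of x y] x mem_irrefl by blast
  have L: "L b a" if "a \<in> I k" "b \<in> I k" "E a b" for a b
  proof -
    have "\<not> L a b" using indiscernible_mem[of y k x a b] x yx that mem_asym[of x y] by blast
    then show ?thesis using L_total[of a b] that mem_irrefl by blast
  qed
  have "def0 E L I {..<k} (\<lambda>e. P (e 2) (e 1) (e 0))"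
    using def0_rename[OF P, of "\<lambda>n. 2 - n"] by simp
  then have "(\<lambda>e. P (e 2) (e 1) (e 0)) (case_nat z (case_nat y (\<lambda>_. x))) =
      (\<lambda>e. P (e 2) (e 1) (e 0)) (case_nat z' (case_nat y' (\<lambda>_. x')))"
    by (rule indiscernible[of k _ 3])
      (use x x' L L_trans[OF L[of y z] L[of x y]] L_trans[OF L[of y' z'] L[of x' y']]
        in \<open>auto split: nat.split\<close>)
  then show ?thesis by (simp add: numeral_2_eq_2)
qed

text \<open>If the conclusion failed for a parameter of rank at most \<open>i\<close>, then by indiscernibility it
  would fail for all \<open>i \<in> \<kappa> \<in> \<lambda>\<close> in \<open>I\<^sub>k\<close>, each time with some parameter of rank at most \<open>i\<close>, and
  mapping \<open>\<kappa>\<close> to the graph of \<open>p \<mapsto> {x. N\<^sub>p \<kappa> i x}\<close> would inject a proper class into a power set.\<close>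

lemma coherence:
  assumes N: "defn UNIV True (\<lambda>e. N (e 0) (e 1) (e 2))"
    and bounded: "\<And>a. \<exists>u. \<forall>\<kappa> x. N \<kappa> a x \<longrightarrow> E x u"
  obtains k i0 where "is_ord E i0"
    "\<And>i \<kappa> \<mu> x. i \<in> I k \<Longrightarrow> \<kappa> \<in> I k \<Longrightarrow> \<mu> \<in> I k \<Longrightarrow> E i0 i \<Longrightarrow> E i \<kappa> \<Longrightarrow> E \<kappa> \<mu> \<Longrightarrow>
       N \<kappa> i x \<longleftrightarrow> N \<mu> i x"
proof -
  obtain Q c where Q: "def0 E L I UNIV Q" "\<And>e. N (e 0) (e 1) (e 2) \<longleftrightarrow> Q (case_nat c e)"
    using N by (rule defn_TrueE) blast
  obtain q where q: "\<forall>e. sat E L I e q \<longleftrightarrow> Q e" using Q(1) unfolding def0_def by blast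
  obtain k where "ind_ok {..<k} q" using ex_ind_ok by blast
  then have Qk: "def0 E L I {..<k} Q" unfolding def0_def using q by blast
  define M where "M p \<kappa> i x \<longleftrightarrow> Q (case_nat p (case_nat \<kappa> (case_nat i (\<lambda>_. x))))" for p \<kappa> i x
  have NM: "N \<kappa> i x \<longleftrightarrow> M c \<kappa> i x" for \<kappa> i x
    using Q(2)[of "case_nat \<kappa> (case_nat i (\<lambda>_. x))"] by (simp add: M_def numeral_2_eq_2)
  have M_rename: "M (e m) (e n) (e r) (e s) \<longleftrightarrow>
      Q (\<lambda>j. e (case_nat m (case_nat n (case_nat r (\<lambda>_. s))) j))" for e :: "nat \<Rightarrow> 'a" and m n r s
    unfolding M_def by (rule arg_cong[where f = Q]) (auto split: nat.split)
  have defn_M: "defn {..<k} False (\<lambda>e. M (e m) (e n) (e r) (e s))"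
    "defn UNIV True (\<lambda>e. M (e m) (e n) (e r) (e s))" for m n r s
    unfolding M_rename using defn_def0[OF def0_rename[OF Qk]] defn_def0[OF def0_rename[OF Q(1)]] by simp_all
  define good where "good i p \<longleftrightarrow> (\<exists>u. \<forall>\<kappa> x. M p \<kappa> i x \<longrightarrow> E x u)" for i p
  define \<Theta> where "\<Theta> i \<kappa> \<mu> \<longleftrightarrow>
    (\<forall>p. rank_le p i \<longrightarrow> good i p \<longrightarrow> (\<forall>x. M p \<kappa> i x \<longleftrightarrow> M p \<mu> i x))" for i \<kappa> \<mu>
  have "defn {..<k} False (\<lambda>e. \<Theta> (e 0) (e 1) (e 2))"
    unfolding \<Theta>_def good_def by (intro defn_intros defn_rank_le defn_M trm_var)
  then have def_\<Theta>: "def0 E L I {..<k} (\<lambda>e. \<Theta> (e 0) (e 1) (e 2))" unfolding defn_def by simp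
  have \<Theta>: "\<Theta> i \<kappa> \<mu>" if I: "i \<in> I k" "\<kappa> \<in> I k" "\<mu> \<in> I k" "E i \<kappa>" "E \<kappa> \<mu>" for i \<kappa> \<mu>
  proof (rule ccontr)
    assume "\<not> \<Theta> i \<kappa> \<mu>"
    \<comment> \<open>Only the last two entries vary; with \<open>i\<close> fixed, all failures
      involve parameters from one set.\<close>
    then have not_\<Theta>: "\<not> \<Theta> i \<nu> \<xi>" if "\<nu> \<in> I k" "\<xi> \<in> I k" "E i \<nu>" "E \<nu> \<xi>" for \<nu> \<xi>
      using indiscernible_triples[OF def_\<Theta> I I(1) that] by simp
    obtain s where s: "\<And>p. rank_le p i \<Longrightarrow> E p s" using rank_le_bounded by blast
    have "\<exists>b. \<forall>p. E p s \<longrightarrow> (\<exists>u. E u b \<and> (good i p \<longrightarrow> (\<forall>\<kappa> x. M p \<kappa> i x \<longrightarrow> E x u)))"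
    proof (rule coll)
      \<comment> \<open>\<open>defn_M\<close> speaks of entries only, so the constant
        \<open>i\<close> enters as a bound variable equal to it.\<close>
      have "defn UNIV True (\<lambda>e. \<exists>j. j = i \<and>
        ((\<exists>u. \<forall>\<kappa> x. M (e 0) \<kappa> j x \<longrightarrow> E x u) \<longrightarrow> (\<forall>\<kappa> x. M (e 0) \<kappa> j x \<longrightarrow> E x (e 1))))"
        by (intro defn_intros defn_M trm_intros)
      then show "defn UNIV True (\<lambda>e. good i (e 0) \<longrightarrow> (\<forall>\<kappa> x. M (e 0) \<kappa> i x \<longrightarrow> E x (e 1)))"
        unfolding good_def by simp
      show "\<exists>u. good i p \<longrightarrow> (\<forall>\<kappa> x. M p \<kappa> i x \<longrightarrow> E x u)" for p
        unfolding good_def by blast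
    qed
    then obtain b where b: "\<And>p. E p s \<Longrightarrow> \<exists>u. E u b \<and> (good i p \<longrightarrow> (\<forall>\<kappa> x. M p \<kappa> i x \<longrightarrow> E x u))"
      by blast
    obtain U where U: "\<And>z. E z U \<longleftrightarrow> (\<exists>y. E y b \<and> E z y)" using ex_union by blast
    obtain W where W: "\<And>p x. E p s \<Longrightarrow> E x U \<Longrightarrow> \<exists>w. E w W \<and> is_opair E w p x"
      using ex_product by blast
    have MU: "E x U" if "rank_le p i" "good i p" "M p \<nu> i x" for p \<nu> x
      unfolding U using b[OF s[OF that(1)]] that by blast
    define D where "D \<nu> \<longleftrightarrow> \<nu> \<in> I k \<and> E i \<nu>" for \<nu>
    define S where "S \<nu> w \<longleftrightarrow> (\<exists>p x. is_opair E w p x \<and> M p \<nu> i x)" for \<nu> w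
    have S_iff: "S \<nu> w \<longleftrightarrow> M p \<nu> i x" if "is_opair E w p x" for \<nu> w p x
      unfolding S_def using that is_opair_inject[OF that] by blast
    have separated_less: "\<exists>w. E w W \<and> S \<nu> w \<noteq> S \<xi> w" if D: "D \<nu>" "D \<xi>" "E \<nu> \<xi>" for \<nu> \<xi>
    proof -
      have "\<not> \<Theta> i \<nu> \<xi>" using not_\<Theta> D unfolding D_def by blast
      then obtain p x where p: "rank_le p i" "good i p" "M p \<nu> i x \<noteq> M p \<xi> i x"
        unfolding \<Theta>_def by blast
      then have "E x U" using MU by blast
      then obtain w where "E w W" "is_opair E w p x" using W s p(1) by blast
      then show ?thesis using S_iff p(3) by blast
    qed
    have "\<exists>b. \<forall>\<nu>. D \<nu> \<longrightarrow> E \<nu> b"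
    proof (rule bounded_if_separated)
      show "defn UNIV True (\<lambda>e. D (e 0))"
        unfolding D_def by (intro defn_intros defn_ind trm_intros UNIV_I)
      have "defn UNIV True (\<lambda>e. \<exists>j. j = i \<and> (\<exists>p x. is_opair E (e 1) p x \<and> M p (e 0) j x))"
        by (intro defn_intros defn_M trm_intros)
      then show "defn UNIV True (\<lambda>e. S (e 0) (e 1))" unfolding S_def by simp
      show "\<exists>w. E w W \<and> S \<nu> w \<noteq> S \<xi> w" if D: "D \<nu>" "D \<xi>" "\<nu> \<noteq> \<xi>" for \<nu> \<xi>
      proof -
        have "E \<nu> \<xi> \<or> E \<xi> \<nu>" using ord_linear[of \<nu> \<xi>] D I_ord unfolding D_def by blast
        then show ?thesis using separated_less[of \<nu> \<xi>] separated_less[of \<xi> \<nu>] D(1,2) by metis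
      qed
    qed
    \<comment> \<open>\<open>D\<close> is a tail of the cofinal class \<open>I k\<close>, so the
      union of a set covering it would contain all ordinals.\<close>
    then obtain d where d: "\<And>\<nu>. D \<nu> \<Longrightarrow> E \<nu> d" by blast
    obtain v where v: "\<And>z. E z v \<longleftrightarrow> (\<exists>y. E y d \<and> E z y)" using ex_union by blast
    have "E x v" if x: "is_ord E x" for x
    proof -
      obtain \<nu> where "\<nu> \<in> I k" "E x \<nu>" "E i \<nu>" using ex_I_above2[OF x I_ord[OF I(1)]] by blast
      then show ?thesis unfolding v using d unfolding D_def by blast
    qed
    then show False using no_set_of_ords by blast
  qed
  obtain i0 where i0: "rank_le c i0" using ex_rank_le by blast
  show thesis
  proof (rule that)
    show "is_ord E i0" using i0 by (rule rank_leD(1))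
    fix i \<kappa> \<mu> x
    assume I: "i \<in> I k" "\<kappa> \<in> I k" "\<mu> \<in> I k" "E i0 i" "E i \<kappa>" "E \<kappa> \<mu>"
    have "rank_le c i" using rank_le_mono[OF i0 I_ord[OF I(1)] I(4)] .
    moreover have "good i c" unfolding good_def using bounded[of i] unfolding NM .
    ultimately show "N \<kappa> i x \<longleftrightarrow> N \<mu> i x"
      using \<Theta>[OF I(1-3,5,6)] unfolding \<Theta>_def NM by blast
  qed
qed

section \<open>Trees\<close>

lemma defn_rel_of:
  "R \<in> X \<Longrightarrow> trm True t \<Longrightarrow> trm True s \<Longrightarrow> defn UNIV True (\<lambda>e. rel_of E R (t e) (s e))"
  by (rule defn_app2) (unfold rel_of_def Bex_def, intro defn_intros defn_class trm_intros)

lemma defn_node_height: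
  "R \<in> X \<Longrightarrow> trm True t \<Longrightarrow> trm True s \<Longrightarrow> defn UNIV True (\<lambda>e. node_height E R (t e) (s e))"
  by (rule defn_app2) (unfold node_height_def is_function_def is_relation_def rel_of_Collect_mem
    Ball_def mem_Collect_eq, intro defn_intros defn_frel defn_ord defn_rel_of trm_intros)

text \<open>The isomorphism at \<open>x\<close> sends some predecessor \<open>y\<close> to
  \<open>\<alpha>\<close>; its restriction \<open>g\<close> to values below \<open>\<alpha>\<close>
  witnesses the height of \<open>y\<close>.\<close>

lemma ex_predecessor_of_height:
  assumes trans: "transp (rel_of E R)"
    and x: "node_height E R x \<kappa>" and \<alpha>: "E \<alpha> \<kappa>"
  shows "\<exists>y. rel_of E R y x \<and> node_height E R y \<alpha>"
proof -
  have ord: "is_ord E \<kappa>" using x unfolding node_height_def by (rule conjunct1)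
  obtain f where f: "is_function E {p. E p f} \<and>
    (\<forall>y. rel_of E R y x \<longleftrightarrow> (\<exists>\<beta>. frel f y \<beta>)) \<and>
    (\<forall>\<beta>. E \<beta> \<kappa> \<longleftrightarrow> (\<exists>y. frel f y \<beta>)) \<and>
    (\<forall>y z \<beta> \<gamma>. frel f y \<beta> \<and> frel f z \<gamma> \<longrightarrow> (y = z \<longleftrightarrow> \<beta> = \<gamma>) \<and> (rel_of E R y z \<longleftrightarrow> E \<beta> \<gamma>))"
    using x unfolding node_height_def rel_of_Collect_mem by (elim conjE exE) (rule that, intro conjI)
  note f = f[THEN conjunct1] f[THEN conjunct2, THEN conjunct1, rule_format]
    f[THEN conjunct2, THEN conjunct2, THEN conjunct1, rule_format]
    f[THEN conjunct2, THEN conjunct2, THEN conjunct2, rule_format, OF conjI]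
  obtain y where y: "frel f y \<alpha>" using f(3) \<alpha> by blast
  have "defn UNIV True (\<lambda>e. \<exists>z \<beta>. is_opair E (e 0) z \<beta> \<and> E \<beta> \<alpha>)" by (intro defn_intros trm_intros)
  from sep[of "\<lambda>p. \<exists>z \<beta>. is_opair E p z \<beta> \<and> E \<beta> \<alpha>", OF this]
  obtain g where g: "\<And>p. E p g \<longleftrightarrow> E p f \<and> (\<exists>z \<beta>. is_opair E p z \<beta> \<and> E \<beta> \<alpha>)" by blast
  have gf: "frel g z \<beta> \<longleftrightarrow> frel f z \<beta> \<and> E \<beta> \<alpha>" for z \<beta>
    unfolding frel_def g by (auto dest: is_opair_inject)
  have "is_function E {p. E p g}"
    using f(1) unfolding is_function_def is_relation_def rel_of_Collect_mem gf using g by blast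
  moreover have "rel_of E R z y \<longleftrightarrow> (\<exists>\<beta>. frel g z \<beta>)" for z
  proof
    assume z: "rel_of E R z y"
    then have "rel_of E R z x" using transpD[OF trans] f(2) y by blast
    then obtain \<beta> where "frel f z \<beta>" using f(2) by blast
    then show "\<exists>\<beta>. frel g z \<beta>" using gf f(4)[OF _ y] z by blast
  next
    assume "\<exists>\<beta>. frel g z \<beta>"
    then show "rel_of E R z y" using gf f(4)[OF _ y] by blast
  qed
  moreover have "E \<beta> \<alpha> \<longleftrightarrow> (\<exists>z. frel g z \<beta>)" for \<beta>
    unfolding gf using f(3)[of \<beta>] ord_trans[OF ord \<alpha>] by blast
  moreover have "(z = z' \<longleftrightarrow> \<beta> = \<gamma>) \<and> (rel_of E R z z' \<longleftrightarrow> E \<beta> \<gamma>)"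
    if "frel g z \<beta>" "frel g z' \<gamma>" for z z' \<beta> \<gamma>
    using f(4) that unfolding gf by blast
  ultimately have "node_height E R y \<alpha>"
    unfolding node_height_def rel_of_Collect_mem using ord_mem[OF ord \<alpha>]
    by (intro conjI exI[of _ g]) blast+
  then show ?thesis using f(2) y by blast
qed

lemma Ord_weakly_compact: "Ord_weakly_compact E X"
  unfolding Ord_weakly_compact_def
proof (intro ballI impI)
  fix T R assume TX: "T \<in> X" and RX: "R \<in> X" and tree: "is_Ord_tree E X T R"
  let ?r = "rel_of E R" and ?h = "node_height E R"
  have tree': "is_tree E X T R"
    and ex: "\<And>\<alpha>. is_ord E \<alpha> \<Longrightarrow> \<exists>x\<in>T. ?h x \<alpha>"
    and level: "\<And>\<alpha>. is_ord E \<alpha> \<Longrightarrow> \<exists>l. \<forall>x. E x l \<longleftrightarrow> x \<in> T \<and> ?h x \<alpha>"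
    using tree unfolding is_Ord_tree_def by simp_all
  have "\<forall>x y. ?r x y \<longrightarrow> x \<in> T \<and> y \<in> T" and "\<forall>x y z. ?r x y \<and> ?r y z \<longrightarrow> ?r x z"
    and "\<forall>x y z. ?r x z \<and> ?r y z \<longrightarrow> ?r x y \<or> x = y \<or> ?r y x"
    using tree' unfolding is_tree_def by - (elim conjE, assumption)+
  then have T: "\<And>x y. ?r x y \<Longrightarrow> x \<in> T" and trans: "\<And>x y z. ?r x y \<Longrightarrow> ?r y z \<Longrightarrow> ?r x z"
    and lin: "\<And>x y z. ?r x z \<Longrightarrow> ?r y z \<Longrightarrow> ?r x y \<or> x = y \<or> ?r y x"
    by blast+
  have transp: "transp ?r" by (rule transpI) (rule trans)
  define top where "top \<kappa> t \<longleftrightarrow> t \<in> T \<and> ?h t \<kappa> \<and> (\<forall>s. s \<in> T \<and> ?h s \<kappa> \<longrightarrow> t = s \<or> L t s)" for \<kappa> t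
  have ex_top: "\<exists>t. top \<kappa> t" if \<kappa>: "is_ord E \<kappa>" for \<kappa>
  proof -
    obtain l where l: "\<And>x. E x l \<longleftrightarrow> x \<in> T \<and> ?h x \<kappa>" using level[OF \<kappa>] by blast
    obtain x where "E x l" using ex[OF \<kappa>] l by blast
    then obtain t where "E t l" "\<And>z. E z l \<Longrightarrow> t = z \<or> L t z" using ex_L_least by blast
    then have "top \<kappa> t" unfolding top_def l by blast
    then show ?thesis by blast
  qed
  have top_fun: "t = s" if "top \<kappa> t" "top \<kappa> s" for \<kappa> t s
    using that L_asym unfolding top_def by blast
  define N where "N \<kappa> a x \<longleftrightarrow> (\<exists>t. top \<kappa> t \<and> ?r x t \<and> ?h x a)" for \<kappa> a x
  have defn_N: "defn UNIV True (\<lambda>e. N (e 0) (e 1) (e 2))"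
    unfolding N_def top_def
    by (intro defn_intros defn_class[OF TX] defn_rel_of[OF RX] defn_node_height[OF RX] trm_intros)
  have bounded: "\<exists>u. \<forall>\<kappa> x. N \<kappa> a x \<longrightarrow> E x u" for a
  proof (cases "is_ord E a")
    case True
    then obtain l where "\<And>x. E x l \<longleftrightarrow> x \<in> T \<and> ?h x a" using level by blast
    then have "\<forall>\<kappa> x. N \<kappa> a x \<longrightarrow> E x l" unfolding N_def using T by blast
    then show ?thesis by blast
  next
    case False
    then show ?thesis unfolding N_def node_height_def by blast
  qed
  obtain k i0 where i0: "is_ord E i0"
    and coh: "\<And>i \<kappa> \<mu> x. i \<in> I k \<Longrightarrow> \<kappa> \<in> I k \<Longrightarrow> \<mu> \<in> I k \<Longrightarrow> E i0 i \<Longrightarrow> E i \<kappa> \<Longrightarrow> E \<kappa> \<mu> \<Longrightarrow>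
       N \<kappa> i x \<longleftrightarrow> N \<mu> i x"
    by (rule coherence[OF defn_N bounded]) (rule that)
  \<comment> \<open>The coherent predecessors occupy only levels in \<open>I k\<close> above
    \<open>i0\<close>; the downward closure fills the remaining ones.\<close>
  define B where "B = {x. \<exists>i \<kappa> y. i \<in> I k \<and> \<kappa> \<in> I k \<and> E i0 i \<and> E i \<kappa> \<and> N \<kappa> i y \<and> (x = y \<or> ?r x y)}"
  have "B \<in> X"
    unfolding B_def
    by (intro Collect_definable defn_intros defn_ind defn_app3[OF defn_N] defn_rel_of[OF RX]
      trm_intros UNIV_I)
  moreover have "is_cofinal_branch E T R B"
    unfolding is_cofinal_branch_def
  proof (intro conjI ballI allI impI)
    show "B \<subseteq> T" unfolding B_def N_def using T by blast
  next
    \<comment> \<open>A node of \<open>B\<close> lies below the \<open>top\<close> node of every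
      sufficiently late level in \<open>I k\<close>. Two nodes therefore share an upper bound, and
      predecessors of one node are comparable.\<close>
    have above: "\<exists>\<kappa>\<in>I k. \<forall>\<mu>\<in>I k. \<forall>t. E \<kappa> \<mu> \<longrightarrow> top \<mu> t \<longrightarrow> ?r x t" if "x \<in> B" for x
    proof -
      obtain i \<kappa> y where *: "i \<in> I k" "\<kappa> \<in> I k" "E i0 i" "E i \<kappa>" "N \<kappa> i y" "x = y \<or> ?r x y"
        using \<open>x \<in> B\<close> unfolding B_def by blast
      have "?r x t" if \<mu>: "\<mu> \<in> I k" "E \<kappa> \<mu>" "top \<mu> t" for \<mu> t
      proof -
        have "N \<mu> i y" using coh[OF *(1,2) \<mu>(1) *(3,4) \<mu>(2)] *(5) by blast
        then have "?r y t" unfolding N_def using top_fun[OF \<mu>(3)] by blast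
        then show ?thesis using *(6) trans by blast
      qed
      then show ?thesis using *(2) by blast
    qed
    fix x y assume xy: "x \<in> B" "y \<in> B"
    obtain \<kappa> where \<kappa>: "\<kappa> \<in> I k" "\<And>\<mu> t. \<mu> \<in> I k \<Longrightarrow> E \<kappa> \<mu> \<Longrightarrow> top \<mu> t \<Longrightarrow> ?r x t"
      using above[OF xy(1)] by blast
    obtain \<nu> where \<nu>: "\<nu> \<in> I k" "\<And>\<mu> t. \<mu> \<in> I k \<Longrightarrow> E \<nu> \<mu> \<Longrightarrow> top \<mu> t \<Longrightarrow> ?r y t"
      using above[OF xy(2)] by blast
    obtain \<mu> where \<mu>: "\<mu> \<in> I k" "E \<kappa> \<mu>" "E \<nu> \<mu>"
      using ex_I_above2[OF I_ord[OF \<kappa>(1)] I_ord[OF \<nu>(1)]] by blast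
    obtain t where "top \<mu> t" using ex_top[OF I_ord[OF \<mu>(1)]] by blast
    then show "?r x y \<or> x = y \<or> ?r y x" using lin \<kappa>(2) \<nu>(2) \<mu> by blast
  next
    fix x y assume "x \<in> B" "?r y x"
    then show "y \<in> B" unfolding B_def using trans by blast
  next
    fix \<alpha> assume \<alpha>: "is_ord E \<alpha>"
    obtain i where i: "i \<in> I k" "E \<alpha> i" "E i0 i" using ex_I_above2[OF \<alpha> i0] by blast
    obtain \<kappa> where \<kappa>: "\<kappa> \<in> I k" "E i \<kappa>" using ex_I_above[OF I_ord[OF i(1)]] by blast
    obtain t where t: "top \<kappa> t" using ex_top[OF I_ord[OF \<kappa>(1)]] by blast
    then have "?h t \<kappa>" unfolding top_def by blast
    then obtain y where y: "?r y t" "?h y i" using ex_predecessor_of_height[OF transp _ \<kappa>(2)] by blast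
    obtain x where x: "?r x y" "?h x \<alpha>" using ex_predecessor_of_height[OF transp y(2) i(2)] by blast
    have "N \<kappa> i y" unfolding N_def using t y by blast
    then have "x \<in> B" unfolding B_def using i \<kappa> x(1) by blast
    then show "\<exists>x\<in>B. ?h x \<alpha>" using x(2) by blast
  qed
  ultimately show "\<exists>B\<in>X. is_cofinal_branch E T R B" by blast
qed

section \<open>The axioms of class theory\<close>

text \<open>A class atom is replaced by the definition of that class, parameter included;
  comprehension thus amounts to closure of definability under connectives and quantifiers over
  elements.\<close>

lemma defn_csat:
  assumes C: "range C \<subseteq> X"
  shows "(\<And>n. trm True (\<tau> n)) \<Longrightarrow> defn UNIV True (\<lambda>e. csat E C (\<lambda>n. \<tau> n e) p)"
proof (induction p arbitrary: \<tau>)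
  case (ClassMember x c)
  have "C c \<in> X" using C by blast
  then show ?case unfolding csat.simps by (rule defn_class) (rule ClassMember)
next
  case (CExi x p)
  have "defn UNIV True (\<lambda>e. csat E C (\<lambda>n. (if n = x then (\<lambda>e. e 0) else (\<lambda>e. \<tau> n (\<lambda>n. e (Suc n)))) e) p)"
    by (rule CExi.IH) (auto intro: trm_var trm_shift CExi.prems)
  moreover have "(\<lambda>n. (if n = x then (\<lambda>e. e 0) else (\<lambda>e. \<tau> n (\<lambda>n. e (Suc n)))) e) =
      (\<lambda>n. \<tau> n (\<lambda>n. e (Suc n)))(x := e 0)" for e
    by auto
  ultimately show ?case unfolding csat.simps by (intro defn_ex) simp
qed (simp_all only: csat.simps, (intro defn_intros; simp)+)

lemma class_comprehension: "class_comprehension E X"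
  unfolding class_comprehension_def
proof (intro allI impI)
  fix p and C :: "nat \<Rightarrow> 'a set" and e :: "nat \<Rightarrow> 'a"
  assume C: "range C \<subseteq> X"
  have "defn UNIV True (\<lambda>e'. csat E C (\<lambda>n. (if n = 0 then (\<lambda>e'. e' 0) else (\<lambda>_. e n)) e') p)"
    by (rule defn_csat[OF C]) (auto intro: trm_var trm_const)
  moreover have "(\<lambda>e'. csat E C (\<lambda>n. (if n = 0 then (\<lambda>e'. e' 0) else (\<lambda>_. e n)) e') p) =
      (\<lambda>e'. csat E C (e(0 := e' 0)) p)"
    by (rule ext, rule arg_cong[where f = "\<lambda>e. csat E C e p"]) auto
  ultimately have "defn UNIV True (\<lambda>e'. csat E C (e(0 := e' 0)) p)"
    by (rule back_subst[where P = "defn UNIV True"])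
  then show "{a. csat E C (e(0 := a)) p} \<in> X" by (rule Collect_definable)
qed

lemma class_replacement: "class_replacement E X"
  unfolding class_replacement_def
proof (intro ballI impI allI)
  fix F a assume F: "F \<in> X" "is_function E F"
  let ?r = "rel_of E F"
  \<comment> \<open>\<open>F\<close> may be undefined at some elements of \<open>a\<close>; the
    premise makes any value acceptable there, and separation removes the surplus.\<close>
  have "\<exists>b. \<forall>x. E x a \<longrightarrow> (\<exists>y. E y b \<and> ((\<exists>z. ?r x z) \<longrightarrow> ?r x y))"
  proof (rule coll)
    show "defn UNIV True (\<lambda>e. (\<exists>z. ?r (e 0) z) \<longrightarrow> ?r (e 0) (e 1))"
      by (intro defn_intros defn_rel_of[OF F(1)] trm_intros)
  qed blast
  then obtain b where b: "\<And>x. E x a \<Longrightarrow> \<exists>y. E y b \<and> ((\<exists>z. ?r x z) \<longrightarrow> ?r x y)" by blast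
  have "defn UNIV True (\<lambda>e. \<exists>x. E x a \<and> ?r x (e 0))"
    by (intro defn_intros defn_rel_of[OF F(1)] trm_intros)
  from sep[of "\<lambda>y. \<exists>x. E x a \<and> ?r x y", OF this]
  obtain c where c: "\<And>y. E y c \<longleftrightarrow> E y b \<and> (\<exists>x. E x a \<and> ?r x y)" by blast
  have "E y b" if "E x a" "?r x y" for x y
    using b[OF that(1)] that(2) F(2) unfolding is_function_def by metis
  then have "\<forall>y. E y c \<longleftrightarrow> (\<exists>x. E x a \<and> ?r x y)" unfolding c by blast
  then show "\<exists>b. \<forall>y. E y b \<longleftrightarrow> (\<exists>x. E x a \<and> ?r x y)" by blast
qed

lemma global_choice: "global_choice E X"
proof -
  define least where "least x y \<longleftrightarrow> E y x \<and> (\<forall>z. E z x \<longrightarrow> y = z \<or> L y z)" for x y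
  define F where "F = {p. \<exists>x y. is_opair E p x y \<and> least x y}"
  have rel: "rel_of E F x y \<longleftrightarrow> least x y" for x y
    unfolding rel_of_def F_def using ex_opair[of x y] by (auto dest: is_opair_inject)
  have "F \<in> X" unfolding F_def least_def by (intro Collect_definable defn_intros trm_intros)
  moreover have "is_function E F"
    unfolding is_function_def is_relation_def rel
  proof (intro conjI allI impI ballI)
    show "\<exists>x y. is_opair E p x y" if "p \<in> F" for p using that unfolding F_def by blast
    show "y = z" if "least x y \<and> least x z" for x y z using that L_asym unfolding least_def by blast
  qed
  moreover have "\<exists>y. E y x \<and> rel_of E F x y" if x: "\<exists>y. E y x" for x
  proof -
    obtain y where "least x y" using x ex_L_least unfolding least_def by blast
    then show ?thesis unfolding rel unfolding least_def by blast
  qed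
  ultimately show ?thesis unfolding global_choice_def by blast
qed

end

theorem theorem4p7:
  fixes E L :: "'a \<Rightarrow> 'a \<Rightarrow> bool" and I :: "nat \<Rightarrow> 'a set" and X :: "'a set set"
  assumes "ZFI_omega E L I"
    and "X = definable_sets E L I"
  shows "GBC E X \<and> Ord_weakly_compact E X"
proof -
  interpret zfi_model E L I by unfold_locales (rule assms(1))
  show ?thesis unfolding assms(2) GBC_def
    using basic_axioms class_foundation class_comprehension class_replacement global_choice
      Ord_weakly_compact by blast
qed

end
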